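(* Let $[\sigma]$ be a circular permutation avoiding $[1432]$. Then the pattern set $[1432,\sigma]$ is Wilf equivalent to a pattern set $[1432,\tau]$ where $[\tau]$ has one of the following forms: (1) $[G(w)]$ with $w = 0^a1^b0^c$, $a \geq c$; (2) $[G(w)]$ with $w$ an alternating binary word starting with $0$ having at least $4$ runs; (3) $[G(w)]$ with $w = B(n_1,n_2,\dots,n_k,1^r)$ having at least $4$ runs, $r \geq 0$, $n_1,n_k \neq 1$, and $(n_k,\dots,n_2,n_1) \leq_{\mathrm{lex}} (n_1,n_2,\dots,n_k)$; (4) $[IG(w)]$ with $w = 0^{n_1}1^{n_2}\cdots 1^{n_k}0^m$ not an alternating binary word, having at least $5$ runs, $m \geq 1$, and $(n_k,\dots,n_2,n_1) \leq_{\mathrm{lex}} (n_1,n_2,\dots,n_k)$.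
   Context: A circular permutation $[\pi]$ of size $n$ is the set of all $n$ rotations of a permutation $\pi$ of $[n]$. $[\sigma]$ contains $[\pi]$ if some rotation of $\sigma$ has a subsequence order-isomorphic to $\pi$; otherwise it avoids $[\pi]$. $\mathrm{Av}_n[\pi_1,\dots,\pi_m]$ is the set of circular permutations of size $n$ avoiding every $[\pi_i]$; two pattern sets are Wilf equivalent if their $\mathrm{Av}_n$ have equal cardinality for all $n\ge1$. A binary word is a finite sequence over $\{0,1\}$; a run is a maximal block of consecutive equal letters. For a composition $(n_1,n_2,\dots)$ (positive parts), $B(n_1,n_2,n_3,\dots)=0^{n_1}1^{n_2}0^{n_3}\cdots$, and $B(n_1,\dots,n_k,1^r)$ means $B(n_1,\dots,n_k,1,\dots,1)$ with $r$ extra parts equal to $1$. For a binary word $w=w_1\cdots w_n$ starting with $0$ with at least $3$ runs, $G(w)$ is the permutation of $[n]$ with exactly one descent such that, for each $i$, $w_i=0$ iff the value $n-i+1$ appears after the descent (so $G(w)$ ends with $n$); if $w$ starts with $0$ and has at most $2$ runs, $G(w)=12\cdots n$. $IG(w)$ is the inverse permutation of $G(w)$. $\leq_{\mathrm{lex}}$ is the lexicographic order on integer sequences. *)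

theory Defs
  imports
    "HOL-Combinatorics.Multiset_Permutations"
    "HOL-Library.Sublist"
    "HOL-Library.List_Lexorder"
    "HOL-Library.Z2"
begin

section \<open>Circular permutations and pattern avoidance\<close>

text \<open>
  A permutation of \<open>[n]\<close> is its one-line notation, an element of
  \<open>permutations_of_set {1..n}\<close>; thus the permutation sends \<open>i\<close> to \<open>p ! (i - 1)\<close>.
\<close>

definition circ :: "nat list \<Rightarrow> nat list set" where
  "circ p = range (\<lambda>k. rotate k p)"

definition order_isomorphic :: "nat list \<Rightarrow> nat list \<Rightarrow> bool" where
  "order_isomorphic s t \<longleftrightarrow> length s = length t \<and>
     (\<forall>i<length s. \<forall>j<length s. s ! i < s ! j \<longleftrightarrow> t ! i < t ! j)"

text \<open>
  Containment is stated on representatives; the lemma \<open>circ_contains_cong\<close> below shows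
  that it only depends on the circular permutations \<open>[s]\<close> and \<open>[p]\<close>.
\<close>

definition circ_contains :: "nat list \<Rightarrow> nat list \<Rightarrow> bool" where
  "circ_contains s p \<longleftrightarrow>
     (\<exists>s' \<in> circ s. \<exists>t. subseq t s' \<and> order_isomorphic t p)"

abbreviation circ_avoids :: "nat list \<Rightarrow> nat list \<Rightarrow> bool" where
  "circ_avoids s p \<equiv> \<not> circ_contains s p"

definition Av :: "nat \<Rightarrow> nat list set \<Rightarrow> nat list set set" where
  "Av n P = {circ s | s. s \<in> permutations_of_set {1..n} \<and> (\<forall>p\<in>P. circ_avoids s p)}"

definition wilf_equivalent :: "nat list set \<Rightarrow> nat list set \<Rightarrow> bool" where
  "wilf_equivalent P Q \<longleftrightarrow> (\<forall>n\<ge>1. card (Av n P) = card (Av n Q))"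


section \<open>Binary words\<close>

text \<open>
  Words have type \<open>bit list\<close>. Compositions are lists of positive naturals; the order
  \<open>\<le>\<close> on them is the lexicographic one from \<open>List_Lexorder\<close>.
\<close>

text \<open>The list \<open>remdups_adj w\<close> keeps exactly one letter of every run.\<close>

definition num_runs :: "bit list \<Rightarrow> nat" where
  "num_runs w = length (remdups_adj w)"

primrec blocks :: "bit \<Rightarrow> nat list \<Rightarrow> bit list" where
  "blocks x [] = []"
| "blocks x (n # ns) = replicate n x @ blocks (x + 1) ns"

definition B :: "nat list \<Rightarrow> bit list" where
  "B ns = blocks 0 ns"

definition composition :: "nat list \<Rightarrow> bool" where
  "composition ns \<longleftrightarrow> (\<forall>n\<in>set ns. n > 0)"


section \<open>The permutations of a binary word\<close>

text \<open>Positions are counted from 0.\<close>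

definition descents :: "nat list \<Rightarrow> nat set" where
  "descents p = {d. Suc d < length p \<and> p ! d > p ! Suc d}"

text \<open>
  With letters counted from 0, the letter \<open>w ! i\<close> governs the value \<open>length w - i\<close>.
  A descent at \<open>d\<close> separates the positions \<open>0, ..., d\<close> from the positions after it.
  Existence and uniqueness, for words starting with 0 with at least 3 runs, are shown
  in \<open>grassmannian_of_ex1\<close>.
\<close>

definition grassmannian_of :: "bit list \<Rightarrow> nat list \<Rightarrow> bool" where
  "grassmannian_of w p \<longleftrightarrow> p \<in> permutations_of_set {1..length w} \<and>
     (\<exists>d. descents p = {d} \<and>
        (\<forall>i<length w. w ! i = 0 \<longleftrightarrow> length w - i \<in> set (drop (Suc d) p)))"

definition G :: "bit list \<Rightarrow> nat list" where
  "G w = (if num_runs w \<le> 2 then [1..<length w + 1] else (THE p. grassmannian_of w p))"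

definition perm_inverse :: "nat list \<Rightarrow> nat list" where
  "perm_inverse p =
     map (\<lambda>v. Suc (inv_into {..<length p} (\<lambda>i. p ! i) v)) [1..<length p + 1]"

definition IG :: "bit list \<Rightarrow> nat list" where
  "IG w = perm_inverse (G w)"


section \<open>Well-definedness\<close>

lemma circ_rotate: "circ (rotate k p) = circ p"
proof
  show "circ (rotate k p) \<subseteq> circ p"
    by (auto simp: circ_def rotate_rotate)
  show "circ p \<subseteq> circ (rotate k p)"
  proof
    fix q assume "q \<in> circ p"
    then obtain m where q: "q = rotate m p" by (auto simp: circ_def)
    have "rotate (m + k * (length p - 1)) (rotate k p) = rotate (m + k * length p) p"
    proof (cases "length p")
      case (Suc l)
      then show ?thesis by (simp add: rotate_rotate algebra_simps)
    qed simp
    also have "\<dots> = q"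
      by (metis q mod_mult_self1 rotate_conv_mod)
    finally show "q \<in> circ (rotate k p)" by (metis circ_def rangeI)
  qed
qed

lemma circ_contains_rotate1:
  assumes "circ_contains s p"
  shows "circ_contains s (rotate1 p)"
proof -
  from assms obtain k t where t: "subseq t (rotate k s)" "order_isomorphic t p"
    by (auto simp: circ_contains_def circ_def)
  have iso: "order_isomorphic (rotate1 t) (rotate1 p)"
    unfolding order_isomorphic_def
  proof (intro conjI allI impI)
    show "length (rotate1 t) = length (rotate1 p)"
      using t(2) by (simp add: order_isomorphic_def)
    fix i j assume ij: "i < length (rotate1 t)" "j < length (rotate1 t)"
    have len: "length p = length t" using t(2) by (simp add: order_isomorphic_def)
    have "Suc i mod length t < length t" "Suc j mod length t < length t"
      using ij by (auto intro!: mod_less_divisor)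
    then show "rotate1 t ! i < rotate1 t ! j \<longleftrightarrow> rotate1 p ! i < rotate1 p ! j"
      using t(2) ij len by (simp add: order_isomorphic_def nth_rotate1)
  qed
  have "\<exists>s'\<in>circ s. subseq (rotate1 t) s'"
  proof (cases t)
    case Nil
    then show ?thesis by (auto simp: circ_def)
  next
    case (Cons x t')
    then obtain a b where ab: "rotate k s = a @ x # b" "subseq t' b"
      using t(1) by (auto dest: list_emb_ConsD)
    have "rotate (Suc (length a)) (rotate k s) = b @ a @ [x]"
      using rotate_append[of "a @ [x]" b] by (simp add: ab(1))
    moreover have "subseq (t' @ [x]) (b @ a @ [x])"
      using ab(2) by (intro list_emb_append_mono list_emb_append2) auto
    ultimately show ?thesis
      using Cons by (metis circ_def rangeI rotate1.simps(2) rotate_rotate)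
  qed
  then show ?thesis using iso by (auto simp: circ_contains_def)
qed

lemma circ_contains_cong:
  assumes "circ s = circ s'" and "circ p = circ p'"
  shows "circ_contains s p \<longleftrightarrow> circ_contains s' p'"
proof -
  have rot: "circ_contains s (rotate k q)" if "circ_contains s q" for k q
    by (induction k) (auto simp: that intro: circ_contains_rotate1)
  have self: "q \<in> circ q" for q
    unfolding circ_def by (metis id_apply rangeI rotate0)
  from assms(2) self obtain k l where "p' = rotate k p" "p = rotate l p'"
    by (metis (no_types, lifting) circ_def imageE)
  then have "circ_contains s p \<longleftrightarrow> circ_contains s p'" using rot by metis
  then show ?thesis using assms(1) by (simp add: circ_contains_def)
qed

lemma subseq_remdups_adj: "subseq (remdups_adj w) w"
  by (induction w rule: remdups_adj.induct) auto

lemma ones_before_zero: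
  assumes "hd w = 0" and "num_runs w \<ge> 3"
  shows "\<exists>i j. i < j \<and> j < length w \<and> w ! i = 1 \<and> w ! j = 0"
proof -
  obtain x y z r where r: "remdups_adj w = x # y # z # r"
    using assms(2) unfolding num_runs_def
    by (metis (no_types) One_nat_def Suc_1 Suc_le_length_iff eval_nat_numeral(3))
  have "x = 0" using r assms(1) by (metis hd_remdups_adj list.sel(1))
  moreover have "distinct_adj (x # y # z # r)"
    using distinct_adj_remdups_adj[of w] r by simp
  ultimately have yz: "y = 1" "z = 0" by auto
  have "subseq (x # y # z # r) w" using subseq_remdups_adj[of w] r by simp
  then have "subseq (y # z # r) w" by (rule subseq_Cons')
  then obtain us vs where w: "w = us @ y # vs" "subseq (z # r) vs"
    by (auto dest: list_emb_ConsD)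
  from w(2) obtain us' vs' where vs: "vs = us' @ z # vs'"
    by (auto dest: list_emb_ConsD)
  have w': "w = us @ y # us' @ z # vs'" by (simp add: w(1) vs)
  have "w ! length us = 1" by (simp add: w' yz)
  moreover have "w ! (length us + Suc (length us')) = 0"
    by (simp add: w' yz nth_append)
  moreover have "length us + Suc (length us') < length w" by (simp add: w')
  ultimately show ?thesis
    by (intro exI[of _ "length us"] exI[of _ "length us + Suc (length us')"]) simp
qed

definition vals :: "bit list \<Rightarrow> bit \<Rightarrow> nat set" where
  "vals w x = {length w - i | i. i < length w \<and> w ! i = x}"

lemma finite_vals [simp]: "finite (vals w x)"
  by (simp add: vals_def)

lemma vals_Un: "vals w 1 \<union> vals w 0 = {1..length w}"
proof -
  have "v \<in> vals w 1 \<union> vals w 0" if "v \<in> {1..length w}" for v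
  proof -
    have "v = length w - (length w - v)" "length w - v < length w"
      using that by auto
    moreover have "w ! (length w - v) = 1 \<or> w ! (length w - v) = 0"
      by (cases "w ! (length w - v)") auto
    ultimately show ?thesis unfolding vals_def by blast
  qed
  moreover have "vals w x \<subseteq> {1..length w}" for x by (auto simp: vals_def)
  ultimately show ?thesis by blast
qed

lemma mem_vals_iff: "i < length w \<Longrightarrow> length w - i \<in> vals w x \<longleftrightarrow> w ! i = x"
proof -
  assume i: "i < length w"
  have "i' = i" if "length w - i = length w - i'" "i' < length w" for i'
    using i that by linarith
  then show ?thesis using i unfolding vals_def by blast
qed

lemma vals_Int: "vals w 1 \<inter> vals w 0 = {}"
proof -
  have False if v: "v \<in> vals w 1" "v \<in> vals w 0" for v
  proof -
    from v(1) obtain i where "i < length w" "v = length w - i" "w ! i = 1"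
      by (auto simp: vals_def)
    then show False using v(2) mem_vals_iff[of i w 0] by simp
  qed
  then show ?thesis by blast
qed

lemma grassmannian_of_unique:
  assumes "grassmannian_of w p"
  shows "p = sorted_list_of_set (vals w 1) @ sorted_list_of_set (vals w 0)"
proof -
  from assms obtain d where p: "set p = {1..length w}" "distinct p" "descents p = {d}"
    and d: "\<And>i. i < length w \<Longrightarrow> w ! i = 0 \<longleftrightarrow> length w - i \<in> set (drop (Suc d) p)"
    by (auto simp: grassmannian_of_def permutations_of_set_def)
  let ?t = "take (Suc d) p" and ?u = "drop (Suc d) p"
  have asc: "p ! i \<le> p ! Suc i" if "Suc i < length p" "i \<noteq> d" for i
    using that p(3) by (fastforce simp: descents_def not_less)
  have "sorted ?t" unfolding sorted_iff_nth_Suc by (auto intro: asc)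
  moreover have "sorted ?u" unfolding sorted_iff_nth_Suc by (auto intro: asc)
  moreover have "distinct ?t" "distinct ?u" using p(2) by auto
  moreover have un: "set ?t \<union> set ?u = {1..length w}"
    by (metis append_take_drop_id p(1) set_append)
  moreover have u: "set ?u = vals w 0"
  proof
    show "set ?u \<subseteq> vals w 0"
    proof
      fix v assume v: "v \<in> set ?u"
      then have "v \<in> {1..length w}" using un by blast
      then have "length w - v < length w" "v = length w - (length w - v)" by auto
      then show "v \<in> vals w 0" using d[of "length w - v"] v unfolding vals_def
        by (metis (mono_tags, lifting) mem_Collect_eq)
    qed
    show "vals w 0 \<subseteq> set ?u" using d by (auto simp: vals_def)
  qed
  moreover have "set ?t = vals w 1"
  proof -
    have "set ?t \<inter> set ?u = {}"
      using p(2) by (metis append_take_drop_id distinct_append)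
    then show ?thesis using un u vals_Un[of w] vals_Int[of w] by blast
  qed
  ultimately have "?t = sorted_list_of_set (vals w 1)" "?u = sorted_list_of_set (vals w 0)"
    by (metis sorted_list_of_set.idem_if_sorted_distinct)+
  then show ?thesis by (metis append_take_drop_id)
qed

lemma grassmannian_of_exists:
  assumes "hd w = 0" and "num_runs w \<ge> 3"
  shows "grassmannian_of w (sorted_list_of_set (vals w 1) @ sorted_list_of_set (vals w 0))"
proof -
  let ?a = "sorted_list_of_set (vals w 1)" and ?b = "sorted_list_of_set (vals w 0)"
  let ?p = "?a @ ?b"
  from ones_before_zero[OF assms] obtain i j
    where ij: "i < j" "j < length w" "w ! i = 1" "w ! j = 0" by blast
  have i: "length w - i \<in> set ?a" and j: "length w - j \<in> set ?b"
    using ij mem_vals_iff[of i w 1] mem_vals_iff[of j w 0] by simp_all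
  define d where "d = length ?a - 1"
  have la: "length ?a = Suc d"
    using i unfolding d_def by (metis Suc_pred' length_pos_if_in_set)
  have lb: "length ?b > 0" using j by (metis length_pos_if_in_set)
  have sa: "sorted ?a" and sb: "sorted ?b" by simp_all
  have "length w - i \<le> ?a ! d"
  proof -
    obtain k where "k < length ?a" "?a ! k = length w - i"
      using i by (meson in_set_conv_nth)
    then show ?thesis using sorted_nth_mono[OF sa, of k d] la by simp
  qed
  moreover have "?b ! 0 \<le> length w - j"
  proof -
    obtain k where "k < length ?b" "?b ! k = length w - j"
      using j by (meson in_set_conv_nth)
    then show ?thesis using sorted_nth_mono[OF sb, of 0 k] by simp
  qed
  ultimately have desc: "?a ! d > ?b ! 0" using ij by linarith
  have "descents ?p = {d}"
  proof (intro equalityI subsetI)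
    fix e assume "e \<in> descents ?p"
    then have e: "Suc e < length ?a + length ?b" "?p ! e > ?p ! Suc e"
      unfolding descents_def by auto
    consider "e < d" | "e = d" | "e > d" by linarith
    then show "e \<in> {d}"
    proof cases
      case 1
      then have "?a ! e \<le> ?a ! Suc e" using sorted_nth_mono[OF sa, of e "Suc e"] la by simp
      then show ?thesis using e(2) 1 la by (simp add: nth_append)
    next
      case 3
      then have "?b ! (e - Suc d) \<le> ?b ! (Suc e - Suc d)"
        using sorted_nth_mono[OF sb, of "e - Suc d" "Suc e - Suc d"] la e(1) by simp
      then show ?thesis using e(2) 3 la by (simp add: nth_append del: diff_Suc_Suc)
    qed simp
  next
    fix e assume "e \<in> {d}"
    then show "e \<in> descents ?p"
      using desc la lb by (simp add: descents_def nth_append)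
  qed
  moreover have "drop (Suc d) ?p = ?b" using la by simp
  moreover have "?p \<in> permutations_of_set {1..length w}"
    using vals_Un[of w] vals_Int[of w] by (auto simp: permutations_of_set_def)
  ultimately show ?thesis
    unfolding grassmannian_of_def using mem_vals_iff[of _ w 0]
    by (intro conjI exI[of _ d] allI impI) (simp_all del: drop_append)
qed

lemma grassmannian_of_ex1:
  assumes "hd w = 0" and "num_runs w \<ge> 3"
  shows "\<exists>!p. grassmannian_of w p"
  using grassmannian_of_exists[OF assms] grassmannian_of_unique by blast

lemma G_eq:
  assumes "hd w = 0" and "num_runs w \<ge> 3"
  shows "G w = sorted_list_of_set (vals w 1) @ sorted_list_of_set (vals w 0)"
proof -
  have "(THE p. grassmannian_of w p) =
      sorted_list_of_set (vals w 1) @ sorted_list_of_set (vals w 0)"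
    by (rule the_equality) (use assms grassmannian_of_exists grassmannian_of_unique in auto)
  then show ?thesis using assms(2) by (simp add: G_def)
qed

end

theory Submission
  imports Defs
begin

text \<open>
  A circular permutation avoiding 1432, rotated so that its maximum comes last, has either all
  inversion tops to the left of all inversion bottoms or all inversion bottoms below all inversion
  tops; otherwise it contains a linear 2143. Hence it is \<open>G w\<close> or \<open>IG w\<close> for a word \<open>w\<close>
  starting with 0. Containment between such permutations is a subword relation: \<open>[G w]\<close> contains
  \<open>[G v]\<close> iff \<open>v\<close> or its complement is a subword of \<open>w\<close>, and \<open>[IG w]\<close> contains \<open>[IG v]\<close> iff
  \<open>1\<^sup>j u\<close> is a subword of \<open>w\<close> for some decomposition \<open>v = u 0\<^sup>j\<close>. With at least five runs the
  two families do not interact, because they are separated by the patterns 24135 and 31425; with at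
  most four runs they coincide.

  For \<open>G\<close> this leaves counting words that contain \<open>v\<close> or its complement. That count is invariant
  under reversal, and prepending a run of length 1 changes it in a way that depends only on the old
  count, so runs of length 1 can be moved from one end to the other. For \<open>IG v\<close> with an even
  number of runs only \<open>v\<close> itself has to be embedded, so the count depends only on the length of
  \<open>v\<close> and agrees with the count for the alternating word. The remaining words are reversed by the
  reverse complement.
\<close>

text \<open>The rotations of 1432 are 1432, 4321, 3214 and 2143. Once the maximum is last it can
  play the 4 of 3214, so a linear 321 is excluded as well as a linear 2143; the structure argument
  rests on these two linear conditions. A word records the values from the largest down, so maximum
  last means first letter 0.

  Subwords may start with 1 or be short, and \<open>G\<close> is not suited to them. Therefore
  \<open>grass\<close> and \<open>inv_grass\<close> are defined on all words, and rotations explain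
  the two subword criteria: swapping the two increasing blocks complements the word, and moving
  final entries to the front trades leading 1s for trailing 0s.

  The obstacle is the overlap of the two families. A pattern with four runs lies in both and is
  contained in members of both, so its count is a sum over both with the common members taken once.
  Besides the count for a word or its complement, this sum involves only numbers fixed by the length
  and the number of runs. The alternating words left out of form (4) are a case where the
  \<open>IG\<close> criterion collapses to the \<open>G\<close> criterion.\<close>

lemma subseq_map_obtain:
  assumes "subseq r (map f zs)"
  obtains zs' where "subseq zs' zs" "r = map f zs'"
  using assms by (metis subseq_conv_nths nths_map)

lemma sorted_wrt_subseq:
  assumes "subseq xs ys" "sorted_wrt R ys"
  shows "sorted_wrt R xs"
  using assms
proof (induction rule: list_emb.induct)
  case (list_emb_Cons2 x y xs ys)
  then show ?case using list_emb_set[OF list_emb_Cons2.hyps(2)] by fastforce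
qed auto

lemma subseq_rev: "subseq xs ys \<Longrightarrow> subseq (rev xs) (rev ys)"
proof (induction rule: list_emb.induct)
  case (list_emb_Cons2 x y xs ys)
  then show ?case by (auto intro: list_emb_append_mono)
qed (auto intro: subseq_rev_drop_many)

lemma subseq_rev_iff: "subseq (rev xs) (rev ys) \<longleftrightarrow> subseq xs ys"
  using subseq_rev[of xs ys] subseq_rev[of "rev xs" "rev ys"] by auto

lemma subseq_nth_map:
  assumes "sorted_wrt (<) js" "\<And>j. j \<in> set js \<Longrightarrow> j < length p"
  shows "subseq (map ((!) p) js) p"
proof -
  have "filter (\<lambda>x. x \<in> set js) [0..<length p] = js"
    by (rule sorted_distinct_set_unique)
      (use assms in \<open>auto simp: strict_sorted_iff sorted_wrt_filter\<close>)
  then have "subseq js [0..<length p]"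
    by (metis subseq_filter_left)
  then have "subseq (map ((!) p) js) (map ((!) p) [0..<length p])"
    by (rule subseq_map)
  then show ?thesis by (simp add: map_nth)
qed

section \<open>Order isomorphism\<close>

lemma order_isomorphic_map_iff:
  "order_isomorphic (map f zs) (map h zs) \<longleftrightarrow>
     (\<forall>x\<in>set zs. \<forall>y\<in>set zs. f x < f y \<longleftrightarrow> h x < h y)"
  by (fastforce simp: order_isomorphic_def in_set_conv_nth)

text \<open>Keeping both sequences as projections of one list of pairs lets a rotation, subsequence
  or reversal act on both at once.\<close>

lemma order_isomorphic_zip:
  assumes "order_isomorphic s t"
  obtains zs where "s = map fst zs" "t = map snd zs"
    "\<And>x y. x \<in> set zs \<Longrightarrow> y \<in> set zs \<Longrightarrow> fst x < fst y \<longleftrightarrow> snd x < snd y"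
proof -
  have "length s = length t" using assms by (simp add: order_isomorphic_def)
  then have "s = map fst (zip s t)" "t = map snd (zip s t)" by simp_all
  then show ?thesis using that assms order_isomorphic_map_iff by metis
qed

lemma order_isomorphic_refl: "order_isomorphic s s"
  by (simp add: order_isomorphic_def)

lemma order_isomorphic_sym: "order_isomorphic s t \<Longrightarrow> order_isomorphic t s"
  by (simp add: order_isomorphic_def)

lemma order_isomorphic_trans:
  "order_isomorphic s t \<Longrightarrow> order_isomorphic t u \<Longrightarrow> order_isomorphic s u"
  by (simp add: order_isomorphic_def)

lemma order_isomorphic_rotate:
  assumes "order_isomorphic s t"
  shows "order_isomorphic (rotate k s) (rotate k t)"
proof -
  obtain zs where "s = map fst zs" "t = map snd zs"
    "\<And>x y. x \<in> set zs \<Longrightarrow> y \<in> set zs \<Longrightarrow> fst x < fst y \<longleftrightarrow> snd x < snd y"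
    using order_isomorphic_zip[OF assms] by blast
  then show ?thesis by (auto simp: rotate_map order_isomorphic_map_iff)
qed

text \<open>The order alone recovers such a permutation: an entry is one more than the number of
  entries below it.\<close>

lemma order_isomorphic_perm_eq:
  assumes "order_isomorphic p q" "p \<in> permutations_of_set {1..n}" "q \<in> permutations_of_set {1..n}"
  shows "p = q"
proof -
  have rank: "r ! i = Suc (card {j. j < length r \<and> r ! j < r ! i})"
    if "r \<in> permutations_of_set {1..n}" "i < length r" for r i
  proof -
    have r: "set r = {1..n}" "distinct r" using that by (auto dest: permutations_of_setD)
    have "r ! i \<in> {1..n}" using r(1) that(2) nth_mem by blast
    have "bij_betw ((!) r) {j. j < length r \<and> r ! j < r ! i} {1..<r ! i}"
    proof (rule bij_betw_imageI)
      show "inj_on ((!) r) {j. j < length r \<and> r ! j < r ! i}"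
        using r(2) by (auto simp: inj_on_def nth_eq_iff_index_eq)
      show "(!) r ` {j. j < length r \<and> r ! j < r ! i} = {1..<r ! i}"
      proof
        show "(!) r ` {j. j < length r \<and> r ! j < r ! i} \<subseteq> {1..<r ! i}"
          using r(1) nth_mem[of _ r] by fastforce
        show "{1..<r ! i} \<subseteq> (!) r ` {j. j < length r \<and> r ! j < r ! i}"
        proof
          fix v assume v: "v \<in> {1..<r ! i}"
          then have "v \<in> set r" using r(1) \<open>r ! i \<in> {1..n}\<close> by auto
          then show "v \<in> (!) r ` {j. j < length r \<and> r ! j < r ! i}"
            using v by (auto simp: in_set_conv_nth)
        qed
      qed
    qed
    then have "card {j. j < length r \<and> r ! j < r ! i} = r ! i - 1"
      by (simp add: bij_betw_same_card)
    then show ?thesis using \<open>r ! i \<in> {1..n}\<close> by simp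
  qed
  have len: "length p = length q" using assms(1) by (simp add: order_isomorphic_def)
  show ?thesis
  proof (rule nth_equalityI[OF len])
    fix i assume i: "i < length p"
    have "{j. j < length p \<and> p ! j < p ! i} = {j. j < length q \<and> q ! j < q ! i}"
      using assms(1) i by (auto simp: order_isomorphic_def)
    then show "p ! i = q ! i" using rank[OF assms(2) i] rank[OF assms(3), of i] i len by simp
  qed
qed

section \<open>Circular containment\<close>

lemma self_in_circ: "p \<in> circ p"
  unfolding circ_def by (metis id_apply rangeI rotate0)

lemma circ_in_circ: "p \<in> circ q \<Longrightarrow> circ p = circ q"
  by (auto simp: circ_rotate circ_def[of q])

lemma circ_sym: "p \<in> circ q \<longleftrightarrow> q \<in> circ p"
  using circ_in_circ self_in_circ by blast

lemma circ_append: "y @ x \<in> circ (x @ y)"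
  by (metis circ_def rangeI rotate_append)

lemma circ_finite_rotations: "p \<noteq> [] \<Longrightarrow> circ p = (\<lambda>k. rotate k p) ` {..<length p}"
  unfolding circ_def
  by (auto simp: image_iff) (metis rotate_conv_mod mod_less_divisor length_greater_0_conv lessThan_iff)

lemma circ_permutation: "p \<in> circ q \<Longrightarrow> q \<in> permutations_of_set A \<Longrightarrow> p \<in> permutations_of_set A"
  by (auto simp: circ_def permutations_of_set_def)

text \<open>Rotating by \<open>k\<close> brings the entry at index \<open>k - 1\<close>, modulo the
  length, to the end, so with distinct entries the last one determines \<open>k\<close>. This makes
  the rotation ending in the maximum a canonical representative.\<close>

lemma circ_last_unique:
  assumes "p \<in> circ q" "distinct q" "last p = last q"
  shows "p = q"
proof (cases "q = []")
  case False
  then obtain k where k: "p = rotate k q" "k < length q"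
    using assms(1) by (auto simp: circ_finite_rotations)
  have "last p = q ! ((k + (length q - 1)) mod length q)"
    using k False by (simp add: last_conv_nth nth_rotate)
  moreover have "last q = q ! (length q - 1)" using False by (simp add: last_conv_nth)
  ultimately have "(k + (length q - 1)) mod length q = length q - 1"
    using assms(2,3) False by (metis diff_less length_greater_0_conv less_numeral_extra(1)
        mod_less_divisor nth_eq_iff_index_eq)
  then have "k = 0"
    using k(2) by (cases k) (simp_all add: mod_if split: if_splits)
  then show ?thesis using k by simp
qed (use assms in \<open>auto simp: circ_def\<close>)

text \<open>One rotation step moves \<open>x\<close> from the front to the end. If the subsequence
  uses this \<open>x\<close>, it is its last entry, and bringing that entry to the front gives a
  subsequence of the list before the step.\<close>

lemma subseq_rotate_obtain:
  assumes "subseq t (rotate k s)"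
  shows "\<exists>l. subseq (rotate l t) s"
  using assms
proof (induction k arbitrary: t)
  case 0
  then show ?case by (auto intro: exI[of _ 0])
next
  case (Suc k)
  show ?case
  proof (cases "rotate k s")
    case Nil
    then show ?thesis using Suc.prems by (auto intro: exI[of _ 0])
  next
    case (Cons x r)
    then have "subseq t (r @ [x])" using Suc.prems by simp
    then obtain t1 t2 where t: "t = t1 @ t2" "subseq t1 r" "subseq t2 [x]"
      by (auto elim: subseq_appendE)
    have "subseq (rotate (length t1) t) (rotate k s)"
    proof (cases "t2 = []")
      case False
      then have "t2 = [x]" using t(3) by (cases t2) (auto split: if_splits)
      then show ?thesis using t Cons by (simp add: rotate_append)
    qed (use t Cons in \<open>auto simp: rotate_append[of _ "[]", simplified]\<close>)
    then show ?thesis using Suc.IH by (metis rotate_rotate)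
  qed
qed

text \<open>Rotating the pattern instead of the host keeps the host fixed as the representative
  ending in its maximum.\<close>

lemma circ_contains_linear:
  "circ_contains s p \<longleftrightarrow> (\<exists>p'\<in>circ p. \<exists>t. subseq t s \<and> order_isomorphic t p')"
proof
  assume "circ_contains s p"
  then obtain k t where t: "subseq t (rotate k s)" "order_isomorphic t p"
    by (auto simp: circ_contains_def circ_def)
  then obtain l where "subseq (rotate l t) s" using subseq_rotate_obtain by blast
  then show "\<exists>p'\<in>circ p. \<exists>t. subseq t s \<and> order_isomorphic t p'"
    using order_isomorphic_rotate[OF t(2), of l] unfolding circ_def by blast
next
  assume "\<exists>p'\<in>circ p. \<exists>t. subseq t s \<and> order_isomorphic t p'"
  then obtain p' t where p: "p' \<in> circ p" "subseq t s" "order_isomorphic t p'" by blast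
  then have "circ_contains s p'"
    unfolding circ_contains_def using self_in_circ by blast
  then show "circ_contains s p" using circ_contains_cong[OF refl circ_in_circ[OF p(1)]] by simp
qed

lemma circ_contains_trans:
  assumes "circ_contains s p" "circ_contains p q"
  shows "circ_contains s q"
proof -
  obtain p' t where p: "p' \<in> circ p" "subseq t s" "order_isomorphic t p'"
    using assms(1) circ_contains_linear by blast
  have "circ_contains p' q" using assms(2) circ_contains_cong circ_in_circ[OF p(1)] by blast
  then obtain q' r where q: "q' \<in> circ q" "subseq r p'" "order_isomorphic r q'"
    using circ_contains_linear by blast
  obtain zs where zs: "t = map fst zs" "p' = map snd zs"
    "\<And>x y. x \<in> set zs \<Longrightarrow> y \<in> set zs \<Longrightarrow> fst x < fst y \<longleftrightarrow> snd x < snd y"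
    using order_isomorphic_zip[OF p(3)] by blast
  obtain zs' where zs': "subseq zs' zs" "r = map snd zs'"
    using q(2) zs(2) by (auto elim: subseq_map_obtain)
  have "set zs' \<subseteq> set zs" using zs'(1) by (auto dest: list_emb_set)
  then have "order_isomorphic (map fst zs') r"
    unfolding zs'(2) order_isomorphic_map_iff using zs(3) by blast
  moreover have "subseq (map fst zs') s"
    using zs'(1) p(2) zs(1) by (metis subseq_map subseq_order.order_trans)
  ultimately show ?thesis
    using q order_isomorphic_trans circ_contains_linear by blast
qed

lemma circ_contains_in_circ: "q' \<in> circ q \<Longrightarrow> circ_contains s q' \<longleftrightarrow> circ_contains s q"
  using circ_contains_cong circ_in_circ by blast

lemma circ_contains_self: "q \<in> circ p \<Longrightarrow> circ_contains p q"
  unfolding circ_contains_def using order_isomorphic_refl by blast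

section \<open>Runs and complements\<close>

definition complement :: "bit list \<Rightarrow> bit list" where
  "complement w = map (\<lambda>x. x + 1) w"

lemma bit_add_one_add_one [simp]: "(x::bit) + 1 + 1 = x"
  by (cases x) simp_all

lemma of_bool_eq_one_bit [simp]: "of_bool (x = 1) = (x::bit)"
  by (cases x) simp_all

lemma complement_simps [simp]:
  "complement [] = []" "complement (x # w) = (x + 1) # complement w" "complement (u @ w) = complement u @ complement w"
  "complement (complement w) = w" "length (complement w) = length w" "complement (rev w) = rev (complement w)"
  "complement w = [] \<longleftrightarrow> w = []"
  by (simp_all add: complement_def rev_map comp_def)

lemma subseq_complement: "subseq (complement u) (complement w) \<longleftrightarrow> subseq u w"
  by (metis complement_def complement_simps(4) subseq_map)

lemma num_runs_Nil [simp]: "num_runs [] = 0"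
  by (simp add: num_runs_def)

lemma num_runs_Cons:
  "num_runs (x # w) = num_runs w + (if w = [] \<or> hd w \<noteq> x then 1 else 0)"
  by (cases w) (auto simp: num_runs_def)

lemma num_runs_pos: "w \<noteq> [] \<Longrightarrow> num_runs w > 0"
  by (auto simp: num_runs_def)

text \<open>A different first letter forces the embedding to skip the first run of \<open>w\<close>;
  recording this extra run is what makes the induction work.\<close>

lemma num_runs_subseq_strong:
  assumes "subseq u w" "u \<noteq> []"
  shows "num_runs u + (if hd u \<noteq> hd w then 1 else 0) \<le> num_runs w"
  using assms
proof (induction rule: list_emb.induct)
  case (list_emb_Cons u w y)
  then have "w \<noteq> []" by auto
  then show ?case using list_emb_Cons by (auto simp: num_runs_Cons split: if_splits)
next
  case (list_emb_Cons2 x y u w)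
  show ?case
  proof (cases "u = []")
    case True
    then show ?thesis using list_emb_Cons2 num_runs_pos[of "y # w"] by (simp add: num_runs_def)
  next
    case False
    then have "w \<noteq> []" using list_emb_Cons2 by auto
    then show ?thesis using list_emb_Cons2 False by (auto simp: num_runs_Cons split: if_splits)
  qed
qed simp

lemma num_runs_subseq: "subseq u w \<Longrightarrow> num_runs u \<le> num_runs w"
  using num_runs_subseq_strong[of u w] by (cases "u = []") auto

section \<open>The permutation of a word without the normalization on short words\<close>

text \<open>The list of values is a parameter because a subsequence of \<open>grass w\<close> has
  the same shape over the smaller list of its own values.\<close>

definition arrange :: "(nat \<Rightarrow> bit) \<Rightarrow> nat list \<Rightarrow> nat list" where
  "arrange f xs = filter (\<lambda>v. f v = 1) xs @ filter (\<lambda>v. f v = 0) xs"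

text \<open>On nonempty words starting with 0 this is \<open>G\<close>; words starting with 1 give
  rotations of such permutations.\<close>

definition grass :: "bit list \<Rightarrow> nat list" where
  "grass w = arrange (\<lambda>v. w ! (length w - v)) [1..<Suc (length w)]"

lemma sorted_list_of_vals:
  "sorted_list_of_set (vals w x) = filter (\<lambda>v. w ! (length w - v) = x) [1..<Suc (length w)]"
proof -
  have "vals w x = set (filter (\<lambda>v. w ! (length w - v) = x) [1..<Suc (length w)])"
  proof (intro equalityI subsetI)
    fix v assume "v \<in> set (filter (\<lambda>v. w ! (length w - v) = x) [1..<Suc (length w)])"
    then have "length w - (length w - v) = v" "length w - v < length w" "w ! (length w - v) = x"
      by auto
    then show "v \<in> vals w x" using mem_vals_iff[of "length w - v" w x] by metis
  qed (auto simp: vals_def)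
  moreover have "sorted (filter Q [1..<Suc k])" "distinct (filter Q [1..<Suc k])" for Q k
    by (auto simp: sorted_wrt_filter simp del: upt_Suc)
  ultimately show ?thesis
    using sorted_list_of_set.idem_if_sorted_distinct by metis
qed

lemma grass_vals: "grass w = sorted_list_of_set (vals w 1) @ sorted_list_of_set (vals w 0)"
  unfolding grass_def arrange_def sorted_list_of_vals ..

lemma grass_perm: "grass w \<in> permutations_of_set {1..length w}"
  using vals_Un[of w] vals_Int[of w] by (auto simp: permutations_of_set_def grass_vals)

lemma length_grass [simp]: "length (grass w) = length w"
  using length_finite_permutations_of_set[OF grass_perm] by simp

text \<open>Complementing exchanges the two increasing blocks, which is a rotation.\<close>

lemma grass_complement: "grass (complement w) \<in> circ (grass w)"
proof -
  have "vals (complement w) x = vals w y" if "y = x + 1" for x y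
  proof -
    have "complement w ! i = x \<longleftrightarrow> w ! i = y" if "i < length w" for i
      using that \<open>y = x + 1\<close> by (cases x; cases "w ! i") (simp_all add: complement_def)
    then show ?thesis by (auto simp: vals_def)
  qed
  then have "vals (complement w) 1 = vals w 0" "vals (complement w) 0 = vals w 1" by simp_all
  then show ?thesis using circ_append by (simp add: grass_vals)
qed

lemma last_grass:
  assumes "w \<noteq> []" "hd w = 0"
  shows "last (grass w) = length w"
proof -
  \<comment> \<open>The letter at index 0 governs the largest value, which therefore belongs to the
    second block.\<close>
  have "length w - 0 \<in> vals w 0"
    using assms mem_vals_iff[of 0 w 0] by (simp add: hd_conv_nth)
  then have "sorted_list_of_set (vals w 0) \<noteq> []" "length w \<in> set (sorted_list_of_set (vals w 0))"
    by auto
  moreover have max_last: "last xs = m" if xs: "sorted xs" "m \<in> set xs" "\<And>x. x \<in> set xs \<Longrightarrow> x \<le> m"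
    for xs :: "nat list" and m
  proof -
    obtain i where i: "i < length xs" "xs ! i = m" using xs(2) by (meson in_set_conv_nth)
    then have "xs \<noteq> []" by auto
    with i have "m \<le> last xs"
      using sorted_nth_mono[OF xs(1), of i "length xs - 1"] by (auto simp: last_conv_nth)
    moreover have "last xs \<in> set xs" using \<open>xs \<noteq> []\<close> by simp
    ultimately show ?thesis using xs(3) by (simp add: antisym)
  qed
  moreover have "x \<le> length w" if "x \<in> set (sorted_list_of_set (vals w 0))" for x
    using that by (auto simp: vals_def)
  ultimately have "last (sorted_list_of_set (vals w 0)) = length w"
    by (intro max_last) simp_all
  then show ?thesis using \<open>sorted_list_of_set (vals w 0) \<noteq> []\<close> by (simp only: grass_vals last_append if_False)
qed

lemma G_eq_grass:
  assumes "w \<noteq> []" "hd w = 0"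
  shows "G w = grass w"
proof (cases "num_runs w \<le> 2")
  case True
  have "a \<le> b" if "a \<in> vals w 1" "b \<in> vals w 0" for a b
  proof (rule ccontr)
    assume "\<not> a \<le> b"
    then obtain i j where ij: "i < j" "j < length w" "w ! i = 1" "w ! j = 0"
    proof -
      obtain i j where "i < length w" "j < length w" "w ! i = 1" "w ! j = 0"
        "a = length w - i" "b = length w - j"
        using \<open>a \<in> vals w 1\<close> \<open>b \<in> vals w 0\<close> unfolding vals_def by blast
      then show ?thesis using that[of i j] \<open>\<not> a \<le> b\<close> by linarith
    qed
    then have "i \<noteq> 0" using assms by (metis hd_conv_nth zero_neq_one)
    \<comment> \<open>With the leading 0 in front, a 1 before a 0 becomes the subword 010, which has
      three runs.\<close>
    then have "subseq (map ((!) w) [0, i, j]) w"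
      using ij by (intro subseq_nth_map) auto
    then have "num_runs [0, 1, 0::bit] \<le> num_runs w"
      using ij assms num_runs_subseq by (simp add: hd_conv_nth)
    then show False using True by (simp add: num_runs_def)
  qed
  then have "sorted (grass w)" by (auto simp: grass_vals sorted_append)
  moreover have "distinct (grass w)" "set (grass w) = set [1..<length w + 1]"
    using grass_perm[of w] by (auto dest: permutations_of_setD)
  ultimately have "grass w = [1..<length w + 1]"
    by (intro sorted_distinct_set_unique) (auto simp del: upt_Suc)
  then show ?thesis using True by (simp add: G_def)
next
  case False
  then show ?thesis using G_eq assms by (simp add: grass_vals)
qed

lemma grass_descent:
  assumes "hd w = 0" "num_runs w \<ge> 3"
  obtains d where "length (sorted_list_of_set (vals w 1)) = Suc d" "descents (grass w) = {d}"
proof -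
  let ?a = "sorted_list_of_set (vals w 1)" and ?b = "sorted_list_of_set (vals w 0)"
  obtain d where d: "descents (grass w) = {d}"
    and l: "\<forall>i<length w. w ! i = 0 \<longleftrightarrow> length w - i \<in> set (drop (Suc d) (grass w))"
    using grassmannian_of_exists[OF assms] unfolding grassmannian_of_def grass_vals by blast
  have "set (drop (Suc d) (grass w)) = set ?b"
  proof -
    have "v \<in> set (drop (Suc d) (grass w)) \<longleftrightarrow> v \<in> vals w 0" if "v \<in> {1..length w}" for v
    proof -
      have "length w - (length w - v) = v" "length w - v < length w" using that by auto
      then show ?thesis using l mem_vals_iff[of "length w - v" w 0] by metis
    qed
    moreover have "set (drop (Suc d) (grass w)) \<subseteq> {1..length w}"
      using permutations_of_setD(1)[OF grass_perm[of w]] by (metis set_drop_subset)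
    moreover have "vals w 0 \<subseteq> {1..length w}" by (auto simp: vals_def)
    ultimately show ?thesis by auto
  qed
  moreover have "distinct (drop (Suc d) (grass w))"
    using grass_perm[of w] by (auto dest: permutations_of_setD)
  ultimately have "length (drop (Suc d) (grass w)) = length ?b"
    by (metis distinct_card distinct_sorted_list_of_set)
  moreover have "Suc d < length (grass w)" using d by (auto simp: descents_def)
  ultimately have "length ?a = Suc d" by (simp add: grass_vals)
  then show ?thesis using that d by blast
qed

text \<open>The descent marks where the first block ends. Both blocks of \<open>grass w'\<close>
  increase, so a descent there can only lie between them, and the blocks of \<open>w\<close> and
  \<open>w'\<close> have equal lengths.\<close>

lemma grass_inj:
  assumes "hd w = 0" "num_runs w \<ge> 3" "grass w = grass w'"
  shows "w = w'"
proof -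
  let ?a = "\<lambda>w. sorted_list_of_set (vals w 1)" and ?b = "\<lambda>w. sorted_list_of_set (vals w 0)"
  obtain d where d: "length (?a w) = Suc d" "descents (grass w) = {d}"
    using grass_descent[OF assms(1,2)] by blast
  then have dd: "Suc d < length (grass w')" "grass w' ! d > grass w' ! Suc d"
    using assms(3) by (auto simp: descents_def)
  have "length (?a w') = Suc d"
  proof (rule ccontr)
    assume ne: "length (?a w') \<noteq> Suc d"
    show False
    proof (cases "Suc d < length (?a w')")
      case True
      then have "grass w' ! d \<le> grass w' ! Suc d"
        using sorted_nth_mono[OF sorted_sorted_list_of_set, of d "Suc d"] by (simp add: grass_vals nth_append)
      then show False using dd by simp
    next
      case False
      then have "length (?a w') \<le> d" using ne by simp
      then have "grass w' ! d \<le> grass w' ! Suc d"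
        using sorted_nth_mono[of "?b w'" "d - length (?a w')" "Suc d - length (?a w')"] dd(1)
        by (simp add: grass_vals nth_append)
      then show False using dd by simp
    qed
  qed
  then have "?a w = ?a w'" "?b w = ?b w'" using d(1) assms(3) by (simp_all add: grass_vals)
  then have v: "vals w 1 = vals w' 1" "vals w 0 = vals w' 0"
    by (metis finite_vals set_sorted_list_of_set)+
  have len: "length w = length w'" using assms(3) length_grass by metis
  show ?thesis
  proof (rule nth_equalityI[OF len])
    fix i assume "i < length w"
    then show "w ! i = w' ! i"
      using mem_vals_iff[of i w 1] mem_vals_iff[of i w' 1] v len
      by (metis bit_not_one_iff)
  qed
qed

section \<open>Patterns in \<open>grass w\<close> and subwords of \<open>w\<close>\<close>

lemma subseq_filter_distinct:
  assumes "subseq t p" "distinct p"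
  shows "t = filter (\<lambda>v. v \<in> set t) p"
  using assms
proof (induction rule: list_emb.induct)
  case (list_emb_Cons t p y)
  then have "y \<notin> set t" by (auto dest: list_emb_set)
  then show ?case using list_emb_Cons by simp
next
  case (list_emb_Cons2 x y t p)
  then have "filter (\<lambda>v. v \<in> set (x # t)) p = filter (\<lambda>v. v \<in> set t) p"
    by (intro filter_cong) auto
  then show ?case using list_emb_Cons2 by simp
qed simp

text \<open>The map \<open>h\<close> from ranks to values is increasing and so preserves the
  pattern. The list is reversed because a word reads the values downwards.\<close>

lemma order_isomorphic_arrange:
  assumes "sorted_wrt (<) xs"
  shows "order_isomorphic (arrange f xs) (grass (map f (rev xs)))"
proof -
  define m where "m = length xs"
  define h where "h k = xs ! (k - 1)" for k
  have xs: "xs = map h [1..<Suc m]"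
    by (rule nth_equalityI) (auto simp: h_def m_def simp del: upt_Suc)
  have 1: "arrange f xs = map h (arrange (f \<circ> h) [1..<Suc m])"
    by (subst (1) xs) (simp add: arrange_def filter_map comp_def del: upt_Suc)
  have 2: "grass (map f (rev xs)) = map id (arrange (f \<circ> h) [1..<Suc m])"
  proof -
    have "map f (rev xs) ! (m - k) = f (h k)" if "k \<in> set [1..<Suc m]" for k
    proof -
      have "k \<ge> 1" "k \<le> m" using that by auto
      then show ?thesis by (auto simp: rev_nth h_def m_def)
    qed
    note letter = this
    have "filter (\<lambda>k. map f (rev xs) ! (m - k) = x) [1..<Suc m] = filter (\<lambda>k. f (h k) = x) [1..<Suc m]" for x
      by (rule filter_cong[OF refl]) (simp only: letter)
    then show ?thesis
      unfolding grass_def arrange_def by (simp add: m_def del: upt_Suc)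
  qed
  have 3: "h i < h j \<longleftrightarrow> i < j" if "i \<in> {1..m}" "j \<in> {1..m}" for i j
  proof -
    have mono: "h i < h j" if "i < j" "i \<in> {1..m}" "j \<in> {1..m}" for i j
      using that assms unfolding h_def m_def
      by (intro sorted_wrt_nth_less[of "(<)" xs]) auto
    show ?thesis using mono[of i j] mono[of j i] that by (metis linorder_neqE_nat order.asym)
  qed
  have 4: "set (arrange (f \<circ> h) [1..<Suc m]) \<subseteq> {1..m}" by (auto simp: arrange_def simp del: upt_Suc)
  show ?thesis
    unfolding 1 2 order_isomorphic_map_iff using 3 4 by (metis id_apply subsetD)
qed

text \<open>A subsequence of \<open>grass w\<close> is a choice of values, that is, of positions in
  \<open>w\<close>; the chosen letters arrange the chosen values in the same way.\<close>

lemma grass_pattern: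
  "(\<exists>t. subseq t (grass w) \<and> order_isomorphic t q) \<longleftrightarrow> (\<exists>v. subseq v w \<and> order_isomorphic (grass v) q)"
proof -
  define f where "f v = w ! (length w - v)" for v
  define L where "L = [1..<Suc (length w)]"
  have grass: "grass w = arrange f L" by (simp add: grass_def f_def[abs_def] L_def)
  have w: "w = map f (rev L)"
    by (rule nth_equalityI) (auto simp: f_def L_def rev_nth simp del: upt_Suc)
  have L: "sorted_wrt (<) L" by (simp add: L_def del: upt_Suc)
  show ?thesis
  proof
    assume "\<exists>t. subseq t (grass w) \<and> order_isomorphic t q"
    then obtain t where t: "subseq t (grass w)" "order_isomorphic t q" by blast
    let ?xs = "filter (\<lambda>v. v \<in> set t) L"
    have "t = filter (\<lambda>v. v \<in> set t) (grass w)"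
      using subseq_filter_distinct[OF t(1)] grass_perm[of w] by (auto dest: permutations_of_setD)
    also have "\<dots> = arrange f ?xs" by (simp add: grass arrange_def conj_commute)
    finally have "order_isomorphic t (grass (map f (rev ?xs)))"
      using order_isomorphic_arrange[of ?xs f] L by (simp add: sorted_wrt_filter)
    moreover have "subseq (map f (rev ?xs)) w"
      by (subst w) (intro subseq_map subseq_rev, simp)
    ultimately show "\<exists>v. subseq v w \<and> order_isomorphic (grass v) q"
      using t(2) order_isomorphic_sym order_isomorphic_trans by blast
  next
    assume "\<exists>v. subseq v w \<and> order_isomorphic (grass v) q"
    then obtain v where v: "subseq v (map f (rev L))" "order_isomorphic (grass v) q" using w by auto
    then obtain ys where ys: "subseq ys (rev L)" "v = map f ys" by (auto elim: subseq_map_obtain)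
    have xs: "subseq (rev ys) L" using ys(1) subseq_rev_iff[of "rev ys" L] by simp
    then have "order_isomorphic (arrange f (rev ys)) (grass v)"
      using order_isomorphic_arrange[of "rev ys" f] sorted_wrt_subseq[OF xs L] ys(2) by simp
    moreover have "subseq (arrange f (rev ys)) (grass w)"
      using xs unfolding grass arrange_def by (intro list_emb_append_mono subseq_filter)
    ultimately show "\<exists>t. subseq t (grass w) \<and> order_isomorphic t q"
      using v(2) order_isomorphic_trans by blast
  qed
qed

text \<open>Stated for an arbitrary map \<open>h\<close> from words to permutations, to serve both
  families. Against a rotation of a permutation \<open>q\<close>, order isomorphism is equality, so
  subwords can be compared with \<open>circ q\<close> directly.\<close>

lemma circ_contains_word_perm:
  assumes pattern: "\<And>q. (\<exists>t. subseq t (h w) \<and> order_isomorphic t q) \<longleftrightarrow>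
      (\<exists>v. subseq v w \<and> order_isomorphic (h v) q)"
    and perm: "\<And>v. h v \<in> permutations_of_set {1..length v}"
    and q: "q \<in> permutations_of_set {1..m}"
  shows "circ_contains (h w) q \<longleftrightarrow> (\<exists>v. subseq v w \<and> h v \<in> circ q)"
proof -
  have "order_isomorphic (h v) q' \<longleftrightarrow> h v = q'" if "q' \<in> circ q" for v q'
  proof
    assume oi: "order_isomorphic (h v) q'"
    have q': "q' \<in> permutations_of_set {1..m}" using circ_permutation[OF that q] .
    have "length v = m"
      using oi length_finite_permutations_of_set[OF q'] length_finite_permutations_of_set[OF perm[of v]]
      by (simp add: order_isomorphic_def)
    then show "h v = q'" using order_isomorphic_perm_eq[OF oi _ q'] perm[of v] by simp
  qed (simp add: order_isomorphic_refl)
  then have "(\<exists>t. subseq t (h w) \<and> order_isomorphic t q') \<longleftrightarrow> (\<exists>v. subseq v w \<and> h v = q')"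
    if "q' \<in> circ q" for q'
    using that by (simp add: pattern)
  then show ?thesis
    unfolding circ_contains_linear by auto
qed

lemmas circ_contains_grass = circ_contains_word_perm[of grass, OF grass_pattern grass_perm]

section \<open>Inverse permutations\<close>

definition inv_grass :: "bit list \<Rightarrow> nat list" where
  "inv_grass w = perm_inverse (grass w)"

lemma IG_eq_inv_grass: "w \<noteq> [] \<Longrightarrow> hd w = 0 \<Longrightarrow> IG w = inv_grass w"
  by (simp add: IG_def inv_grass_def G_eq_grass)

definition position :: "nat list \<Rightarrow> nat \<Rightarrow> nat" where
  "position p v = inv_into {..<length p} ((!) p) v"

lemma position:
  assumes "v \<in> set p"
  shows "position p v < length p" "p ! position p v = v"
proof -
  have "v \<in> (!) p ` {..<length p}" using assms by (auto simp: in_set_conv_nth)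
  then show "position p v < length p" "p ! position p v = v"
    unfolding position_def using inv_into_into[of v "(!) p" "{..<length p}"]
    by (auto simp: f_inv_into_f)
qed

lemma perm_inverse_nth: "i < length p \<Longrightarrow> perm_inverse p ! i = Suc (position p (Suc i))"
  by (simp add: perm_inverse_def position_def nth_map nth_upt less_diff_conv del: upt_Suc)

lemma length_perm_inverse [simp]: "length (perm_inverse p) = length p"
  by (simp add: perm_inverse_def del: upt_Suc)

lemma perm_inverse_perm:
  assumes p: "p \<in> permutations_of_set {1..n}"
  shows "perm_inverse p \<in> permutations_of_set {1..n}"
proof -
  have set: "set p = {1..n}" and len: "length p = n"
    using permutations_of_setD[OF p] length_finite_permutations_of_set[OF p] by auto
  have pp: "p ! position p (Suc i) = Suc i" "position p (Suc i) < n" if "i < n" for i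
    using that position[of "Suc i" p] by (auto simp: set len)
  have "distinct (perm_inverse p)"
    unfolding distinct_conv_nth using pp(1) by (simp add: perm_inverse_nth len) (metis Suc_inject)
  moreover have "set (perm_inverse p) \<subseteq> {1..n}"
  proof
    fix x assume "x \<in> set (perm_inverse p)"
    then obtain i where "i < n" "x = perm_inverse p ! i" by (auto simp: in_set_conv_nth len)
    then show "x \<in> {1..n}" using pp(2)[of i] by (simp add: perm_inverse_nth len)
  qed
  ultimately have "set (perm_inverse p) = {1..n}"
    by (intro card_subset_eq) (simp_all add: distinct_card len)
  then show ?thesis using \<open>distinct _\<close> by (simp add: permutations_of_set_def)
qed

lemma perm_inverse_inj:
  assumes p: "p \<in> permutations_of_set {1..n}" and q: "q \<in> permutations_of_set {1..n}"
    and eq: "perm_inverse p = perm_inverse q"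
  shows "p = q"
proof -
  have set: "set p = {1..n}" "set q = {1..n}" and len: "length p = n" "length q = n"
    and dist: "distinct p"
    using permutations_of_setD[OF p] permutations_of_setD[OF q]
      length_finite_permutations_of_set[OF p] length_finite_permutations_of_set[OF q] by auto
  show ?thesis
  proof (rule nth_equalityI)
    fix k assume k: "k < length p"
    define i where "i = p ! k - 1"
    have v: "p ! k \<in> {1..n}" using k set nth_mem by blast
    then have i: "i < n" "Suc i = p ! k" by (auto simp: i_def)
    have "position p (Suc i) = position q (Suc i)"
      using perm_inverse_nth[of i p] perm_inverse_nth[of i q] i(1) len eq by simp
    moreover have "position p (Suc i) = k"
      using position[of "Suc i" p] v i set dist k by (metis nth_eq_iff_index_eq)
    ultimately show "p ! k = q ! k" using position(2)[of "Suc i" q] v i set by simp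
  qed (simp add: len)
qed

lemma inv_grass_perm: "inv_grass w \<in> permutations_of_set {1..length w}"
  unfolding inv_grass_def by (rule perm_inverse_perm[OF grass_perm])

lemma length_inv_grass [simp]: "length (inv_grass w) = length w"
  by (simp add: inv_grass_def)

lemma inv_grass_inj:
  assumes "hd w = 0" "num_runs w \<ge> 3" "inv_grass w = inv_grass w'"
  shows "w = w'"
proof -
  have "length w = length w'" using assms(3) length_inv_grass by metis
  then have "grass w = grass w'"
    using perm_inverse_inj[of "grass w" "length w" "grass w'"] assms(3) grass_perm[of w] grass_perm[of w']
    by (simp add: inv_grass_def)
  then show ?thesis using grass_inj assms(1,2) by blast
qed

section \<open>Standardization of binary words\<close>

definition std_rel :: "nat \<times> bit \<Rightarrow> nat \<times> bit \<Rightarrow> bool" where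
  "std_rel a b \<longleftrightarrow> (if snd a = 0 \<and> snd b = 1 then fst b < fst a else fst a < fst b)"

text \<open>The entries rank the letters of \<open>u\<close>, with 1 counted below 0 and equal
  letters ranked from left to right. As a pairwise condition on a list of pairs it passes to
  sublists and can be decided by evaluation.\<close>

definition standardizes :: "nat list \<Rightarrow> bit list \<Rightarrow> bool" where
  "standardizes s u \<longleftrightarrow> length s = length u \<and> sorted_wrt std_rel (zip s u)"

lemma standardizes_nth:
  "standardizes s u \<longleftrightarrow> length s = length u \<and>
     (\<forall>i j. i < j \<longrightarrow> j < length u \<longrightarrow> (if u ! i = 0 \<and> u ! j = 1 then s ! j < s ! i else s ! i < s ! j))"
  unfolding standardizes_def sorted_wrt_iff_nth_less by (auto simp: std_rel_def)

lemma standardizes_order_isomorphic: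
  assumes "standardizes s u" "standardizes t u"
  shows "order_isomorphic s t"
  unfolding order_isomorphic_def
proof (intro conjI allI impI)
  show "length s = length t" using assms by (simp add: standardizes_def)
  fix i j assume "i < length s" "j < length s"
  then show "s ! i < s ! j \<longleftrightarrow> t ! i < t ! j"
    using assms unfolding standardizes_nth
    by (cases i j rule: linorder_cases) (metis order.asym)+
qed

text \<open>An entry of the inverse is the place of a value in \<open>grass w\<close>. There the
  values with letter 1 precede those with letter 0, increasing within each class, and
  \<open>rev w\<close> lists the letters in increasing order of the values.\<close>

lemma inv_grass_standardizes: "standardizes (inv_grass w) (rev w)"
  unfolding standardizes_nth
proof (intro conjI allI impI)
  define n where "n = length w"
  define f where "f v = w ! (n - v)" for v
  have grass: "grass w = arrange f [1..<Suc n]" by (simp add: grass_def f_def[abs_def] n_def)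
  \<comment> \<open>\<open>Q\<close> is the order in which the values occur in
    \<open>grass w\<close>.\<close>
  define Q where "Q a b \<longleftrightarrow> (f a = 1 \<and> f b = 0) \<or> (f a = f b \<and> a < b)" for a b
  have "sorted_wrt Q (grass w)"
    unfolding grass arrange_def sorted_wrt_append
  proof (intro conjI)
    have inc: "sorted_wrt (<) (filter (\<lambda>v. f v = x) [1..<Suc n])" for x
      by (simp add: sorted_wrt_filter del: upt_Suc)
    have "sorted_wrt Q (filter (\<lambda>v. f v = x) [1..<Suc n])" for x
      by (rule sorted_wrt_mono_rel[OF _ inc]) (auto simp: Q_def simp del: upt_Suc)
    then show "sorted_wrt Q (filter (\<lambda>v. f v = 1) [1..<Suc n])"
      "sorted_wrt Q (filter (\<lambda>v. f v = 0) [1..<Suc n])" by blast+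
  qed (simp add: Q_def del: upt_Suc)
  then have Q: "Q (grass w ! i) (grass w ! j)" if "i < j" "j < n" for i j
    using that sorted_wrt_nth_less[of Q "grass w" i j] by (simp add: n_def)
  fix i j assume ij: "i < j" "j < length (rev w)"
  have set: "set (grass w) = {1..n}" using permutations_of_setD(1)[OF grass_perm[of w]] by (simp add: n_def)
  define a b where "a = position (grass w) (Suc i)" and "b = position (grass w) (Suc j)"
  have a: "a < n" "grass w ! a = Suc i" and b: "b < n" "grass w ! b = Suc j"
    using position[of "Suc i" "grass w"] position[of "Suc j" "grass w"] ij
    by (auto simp: set a_def b_def n_def)
  have f: "rev w ! i = f (Suc i)" "rev w ! j = f (Suc j)"
    using ij by (simp_all add: rev_nth f_def n_def)
  have inv_grass: "inv_grass w ! i = Suc a" "inv_grass w ! j = Suc b"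
    using ij by (simp_all add: inv_grass_def perm_inverse_nth a_def b_def)
  have "a \<noteq> b" using a b ij by auto
  then consider "a < b" | "b < a" by linarith
  then show "if rev w ! i = 0 \<and> rev w ! j = 1 then inv_grass w ! j < inv_grass w ! i else inv_grass w ! i < inv_grass w ! j"
  proof cases
    case 1
    then show ?thesis using Q[of a b] a b ij by (auto simp: f inv_grass Q_def)
  next
    case 2
    then show ?thesis using Q[of b a] a b ij by (auto simp: f inv_grass Q_def)
  qed
qed simp

text \<open>The pattern of a standardization depends only on its word, so recognizing
  \<open>inv_grass\<close> amounts to checking comparisons against letters.\<close>

lemma standardizes_perm_eq:
  assumes "standardizes s u" "s \<in> permutations_of_set {1..n}"
  shows "s = inv_grass (rev u)"
proof -
  have "length u = n"
    using assms length_finite_permutations_of_set[OF assms(2)] by (simp add: standardizes_def)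
  then show ?thesis
    using order_isomorphic_perm_eq[OF standardizes_order_isomorphic[OF assms(1)] assms(2)]
      inv_grass_standardizes[of "rev u"] inv_grass_perm[of "rev u"] by simp
qed

text \<open>Each entry is paired with its letter, so selecting positions restricts the permutation
  and the word together; a restriction of a standardization is again one.\<close>

lemma inv_grass_pattern:
  "(\<exists>t. subseq t (inv_grass w) \<and> order_isomorphic t q) \<longleftrightarrow> (\<exists>v. subseq v w \<and> order_isomorphic (inv_grass v) q)"
proof -
  let ?z = "zip (inv_grass w) (rev w)"
  have z: "map fst ?z = inv_grass w" "map snd ?z = rev w" by simp_all
  have key: "order_isomorphic (map fst zs) (inv_grass (rev (map snd zs)))" if "subseq zs ?z" for zs
  proof -
    have "standardizes (map fst zs) (map snd zs)"
      using sorted_wrt_subseq[OF that] inv_grass_standardizes[of w]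
      by (simp add: standardizes_def zip_map_fst_snd)
    then show ?thesis
      using standardizes_order_isomorphic inv_grass_standardizes[of "rev (map snd zs)"] by simp
  qed
  show ?thesis
  proof
    assume "\<exists>t. subseq t (inv_grass w) \<and> order_isomorphic t q"
    then obtain t where t: "subseq t (map fst ?z)" "order_isomorphic t q" using z by metis
    then obtain zs where zs: "subseq zs ?z" "t = map fst zs" by (elim subseq_map_obtain)
    have "subseq (map snd zs) (rev w)" using subseq_map[OF zs(1), of snd] z by simp
    then have "subseq (rev (map snd zs)) w" using subseq_rev_iff by fastforce
    then show "\<exists>v. subseq v w \<and> order_isomorphic (inv_grass v) q"
      using key[OF zs(1)] zs(2) t(2) order_isomorphic_sym order_isomorphic_trans by blast
  next
    assume "\<exists>v. subseq v w \<and> order_isomorphic (inv_grass v) q"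
    then obtain v where v: "subseq v w" "order_isomorphic (inv_grass v) q" by blast
    then have "subseq (rev v) (map snd ?z)" using subseq_rev z by simp
    then obtain zs where zs: "subseq zs ?z" "rev v = map snd zs" by (elim subseq_map_obtain)
    have "subseq (map fst zs) (inv_grass w)" using subseq_map[OF zs(1), of fst] z by simp
    moreover have "order_isomorphic (map fst zs) (inv_grass v)"
      using key[OF zs(1)] zs(2) by (metis rev_rev_ident)
    ultimately show "\<exists>t. subseq t (inv_grass w) \<and> order_isomorphic t q"
      using v(2) order_isomorphic_trans by blast
  qed
qed

lemmas circ_contains_inv_grass = circ_contains_word_perm[of inv_grass, OF inv_grass_pattern inv_grass_perm]

lemma standardizes_append:
  "length s = length u \<Longrightarrow> standardizes (s @ s') (u @ u') \<longleftrightarrow>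
     standardizes s u \<and> standardizes s' u' \<and>
     (\<forall>a\<in>set (zip s u). \<forall>b\<in>set (zip s' u'). std_rel a b)"
  by (auto simp: standardizes_def sorted_wrt_append)

text \<open>In the reversed word the \<open>j\<close> leading 1s stand at the end. Moved to the
  front and relabelled 0 they keep all comparisons: an entry with letter 1 is smaller than an
  earlier 0 and larger than an earlier 1, which is what a 0 must be towards a later 0 and a later
  1.\<close>

lemma inv_grass_rotate: "inv_grass (u @ replicate j 0) \<in> circ (inv_grass (replicate j 1 @ u))"
proof -
  define p where "p = inv_grass (replicate j 1 @ u)"
  define p1 p2 where "p1 = take (length u) p" and "p2 = drop (length u) p"
  have len: "length p1 = length u" "length p2 = j" by (simp_all add: p1_def p2_def p_def)
  have "standardizes (p1 @ p2) (rev u @ replicate j 1)"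
    using inv_grass_standardizes[of "replicate j 1 @ u"] by (simp add: p1_def p2_def p_def)
  then have 1: "standardizes p1 (rev u)" "standardizes p2 (replicate j 1)"
    "\<And>a b. a \<in> set (zip p1 (rev u)) \<Longrightarrow> b \<in> set (zip p2 (replicate j 1)) \<Longrightarrow> std_rel a b"
    by (auto simp: standardizes_append len)
  have "standardizes p2 (replicate j 0)"
    using 1(2) by (simp add: standardizes_nth)
  moreover have "std_rel b a" if "a \<in> set (zip p1 (rev u))" "b \<in> set (zip p2 (replicate j 0))" for a b
  proof -
    have "(fst b, 1) \<in> set (zip p2 (replicate j 1))" "snd b = 0"
      using that(2) by (auto simp: in_set_zip)
    then show ?thesis using 1(3)[OF that(1)] unfolding std_rel_def
      by (metis bit_not_one_iff fst_conv snd_conv)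
  qed
  ultimately have "standardizes (p2 @ p1) (replicate j 0 @ rev u)"
    using 1(1) by (simp add: standardizes_append len)
  moreover have "p2 @ p1 \<in> circ p"
    using circ_append[of p2 p1] by (simp add: p1_def p2_def)
  moreover from this have "p2 @ p1 \<in> permutations_of_set {1..j + length u}"
    using circ_permutation[of _ p] inv_grass_perm[of "replicate j 1 @ u"] by (simp add: p_def)
  ultimately show ?thesis using standardizes_perm_eq by (fastforce simp: p_def)
qed

lemma last_inv_grass:
  assumes "w \<noteq> []" "hd w = 0"
  shows "last (inv_grass w) = length w"
proof -
  define n where "n = length w"
  have n: "n > 0" using assms by (simp add: n_def)
  have std: "inv_grass w ! i < inv_grass w ! (n - 1)" if "i < n - 1" for i
  proof -
    \<comment> \<open>The last letter of the reversed word is 0, so the last entry exceeds all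
      earlier ones.\<close>
    have "rev w ! (n - 1) = 0" using assms n by (simp add: rev_nth n_def hd_conv_nth)
    then show ?thesis
      using inv_grass_standardizes[of w] that unfolding standardizes_nth
      by (metis n diff_less length_rev less_numeral_extra(1) n_def zero_neq_one)
  qed
  have set: "set (inv_grass w) = {1..n}" using permutations_of_setD(1)[OF inv_grass_perm] n_def by simp
  then obtain i where i: "i < n" "inv_grass w ! i = n"
    using n by (metis atLeastAtMost_iff in_set_conv_nth length_inv_grass le_refl n_def Suc_leI One_nat_def)
  have "inv_grass w ! (n - 1) \<in> {1..n}" using set n nth_mem[of "n - 1" "inv_grass w"] by (simp add: n_def)
  then have "i = n - 1" using std[of i] i by (cases "i < n - 1") auto
  moreover have "inv_grass w \<noteq> []" using assms by (metis length_0_conv length_inv_grass)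
  ultimately show ?thesis using i by (simp add: last_conv_nth n_def)
qed

section \<open>Small patterns\<close>

lemma circ_code: "p \<noteq> [] \<Longrightarrow> circ p = set (map (\<lambda>k. rotate k p) [0..<length p])"
  by (auto simp: circ_finite_rotations)

lemma grass_two_increasing: "\<exists>k\<le>length w. sorted (take k (grass w)) \<and> sorted (drop k (grass w))"
proof (intro exI[of _ "length (sorted_list_of_set (vals w 1))"] conjI)
  show "length (sorted_list_of_set (vals w 1)) \<le> length w"
    using length_grass[of w] unfolding grass_vals by simp
qed (simp_all add: grass_vals)

text \<open>Reduces avoidance to a finite check, run by evaluation: no rotation of \<open>q\<close>
  splits into two increasing pieces.\<close>

lemma grass_avoids:
  assumes "q \<in> permutations_of_set {1..m}" "q \<noteq> []"
    and "\<forall>q'\<in>set (map (\<lambda>k. rotate k q) [0..<length q]). \<forall>k\<in>set [0..<Suc (length q)].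
      \<not> (sorted (take k q') \<and> sorted (drop k q'))"
  shows "circ_avoids (grass w) q"
proof
  assume "circ_contains (grass w) q"
  then obtain v where v: "grass v \<in> circ q" using circ_contains_grass[OF assms(1)] by blast
  then have "length v = length q"
    using length_finite_permutations_of_set[OF circ_permutation[OF v assms(1)]]
      length_finite_permutations_of_set[OF assms(1)] by simp
  moreover obtain k where "k \<le> length v" "sorted (take k (grass v))" "sorted (drop k (grass v))"
    using grass_two_increasing by blast
  ultimately show False using v assms(3) circ_code[OF assms(2)] by (auto simp: less_Suc_eq_le simp del: upt_Suc)
qed

lemma grass_avoids_1432: "circ_avoids (grass w) [1, 4, 3, 2]"
  by (rule grass_avoids[of _ 4]) (force simp: permutations_of_set_def, simp, code_simp)

lemma grass_avoids_31425: "circ_avoids (grass w) [3, 1, 4, 2, 5]"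
  by (rule grass_avoids[of _ 5]) (force simp: permutations_of_set_def, simp, code_simp)

text \<open>The analogous finite check: no rotation of \<open>q\<close> is the standardization of a
  binary word of its length.\<close>

lemma inv_grass_avoids:
  assumes "q \<in> permutations_of_set {1..m}" "q \<noteq> []"
    and "\<forall>q'\<in>set (map (\<lambda>k. rotate k q) [0..<length q]). \<forall>u\<in>set (List.n_lists (length q) [0, 1]).
      \<not> sorted_wrt std_rel (zip q' u)"
  shows "circ_avoids (inv_grass w) q"
proof
  assume "circ_contains (inv_grass w) q"
  then obtain v where v: "inv_grass v \<in> circ q" using circ_contains_inv_grass[OF assms(1)] by blast
  then have len: "length v = length q"
    using length_finite_permutations_of_set[OF circ_permutation[OF v assms(1)]]
      length_finite_permutations_of_set[OF assms(1)] by simp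
  have "x \<in> {0, 1}" for x :: bit by (cases x) auto
  then have "rev v \<in> set (List.n_lists (length q) [0, 1])"
    using len by (auto simp: set_n_lists)
  moreover have "sorted_wrt std_rel (zip (inv_grass v) (rev v))"
    using inv_grass_standardizes by (simp add: standardizes_def)
  ultimately show False using v assms(3) unfolding circ_code[OF assms(2)] by blast
qed

lemma inv_grass_avoids_1432: "circ_avoids (inv_grass w) [1, 4, 3, 2]"
  by (rule inv_grass_avoids[of _ 4]) (force simp: permutations_of_set_def, simp, code_simp)

lemma inv_grass_avoids_24135: "circ_avoids (inv_grass w) [2, 4, 1, 3, 5]"
  by (rule inv_grass_avoids[of _ 5]) (force simp: permutations_of_set_def, simp, code_simp)

section \<open>Separating words with at least five runs\<close>

lemma alternating_subseq:
  assumes "hd w = 0" "num_runs w \<ge> 5"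
  shows "subseq [0, 1, 0, 1, 0] w"
proof -
  have "length (remdups_adj w) \<ge> 5" using assms(2) by (simp add: num_runs_def)
  then obtain a b c d e r where r: "remdups_adj w = a # b # c # d # e # r"
    by (auto simp: numeral_eq_Suc Suc_le_length_iff)
  have "w \<noteq> []" using assms(2) by auto
  then have "a = 0" using r assms(1) by (metis hd_remdups_adj list.sel(1))
  moreover have "distinct_adj (a # b # c # d # e # r)"
    using distinct_adj_remdups_adj[of w] r by simp
  ultimately have "remdups_adj w = [0, 1, 0, 1, 0] @ r" using r by auto
  then show ?thesis
    using subseq_remdups_adj[of w] by (metis subseq_order.order_trans subseq_rev_drop_many subseq_order.order_refl)
qed

text \<open>24135 is \<open>G\<close> of 01010, the shortest word with five runs starting with 0;
  31425 is the inverse of 24135.\<close>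

lemma grass_contains_24135:
  assumes "hd w = 0" "num_runs w \<ge> 5"
  shows "circ_contains (grass w) [2, 4, 1, 3, 5]"
proof -
  have "grass [0, 1, 0, 1, 0] = [2, 4, 1, 3, 5]" by code_simp
  then have "grass [0, 1, 0, 1, 0] \<in> circ [2, 4, 1, 3, 5]" by (simp add: self_in_circ)
  moreover have "[2, 4, 1, 3, 5] \<in> permutations_of_set {1..5::nat}"
    by (force simp: permutations_of_set_def)
  ultimately show ?thesis using alternating_subseq[OF assms] circ_contains_grass by blast
qed

lemma inv_grass_contains_31425:
  assumes "hd w = 0" "num_runs w \<ge> 5"
  shows "circ_contains (inv_grass w) [3, 1, 4, 2, 5]"
proof -
  have p: "[3, 1, 4, 2, 5] \<in> permutations_of_set {1..5::nat}"
    by (force simp: permutations_of_set_def)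
  have "standardizes [3, 1, 4, 2, 5] [0, 1, 0, 1, 0]" by (simp add: standardizes_def std_rel_def)
  then have "inv_grass [0, 1, 0, 1, 0] = [3, 1, 4, 2, 5]" using standardizes_perm_eq[OF _ p] by fastforce
  then have "inv_grass [0, 1, 0, 1, 0] \<in> circ [3, 1, 4, 2, 5]" by (simp add: self_in_circ)
  then show ?thesis using p alternating_subseq[OF assms] circ_contains_inv_grass by blast
qed

section \<open>Circular permutations avoiding 1432\<close>

definition zero_words :: "nat \<Rightarrow> bit list set" where
  "zero_words n = {w. length w = n \<and> w \<noteq> [] \<and> hd w = 0}"

text \<open>A circular permutation is represented by its rotation ending in the maximum. For size 0
  the set is empty, in agreement with \<open>zero_words\<close>.\<close>

definition avoiders :: "nat \<Rightarrow> nat list set" where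
  "avoiders n = {p \<in> permutations_of_set {1..n}. p \<noteq> [] \<and> last p = n \<and> circ_avoids p [1, 4, 3, 2]}"

definition inversion :: "nat list \<Rightarrow> nat \<Rightarrow> nat \<Rightarrow> bool" where
  "inversion p i j \<longleftrightarrow> i < j \<and> j < length p \<and> p ! j < p ! i"

lemma length_circ: "p \<in> circ q \<Longrightarrow> length p = length q"
  by (auto simp: circ_def)

lemma circ_contains_indices:
  assumes "sorted_wrt (<) js" "\<And>j. j \<in> set js \<Longrightarrow> j < length p"
    and "order_isomorphic (map ((!) p) js) q'" "q' \<in> circ q"
  shows "circ_contains p q"
  using subseq_nth_map[OF assms(1,2)] assms(3,4) circ_contains_linear by blast

text \<open>Without 321 no entry is both a top and a bottom of inversions, and the tops increase
  from left to right, as do the bottoms. If both alternatives fail, there are a top \<open>t\<close>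
  below a bottom \<open>b\<close> and a top \<open>t'\<close> to the right of a bottom
  \<open>b'\<close>; these entries or their inversion partners form a 2143.\<close>

lemma inversion_dichotomy:
  assumes dist: "distinct p"
    and no321: "\<And>i j k. inversion p i j \<Longrightarrow> inversion p j k \<Longrightarrow> False"
    and no2143: "\<And>i j k l. i < j \<Longrightarrow> j < k \<Longrightarrow> k < l \<Longrightarrow> l < length p \<Longrightarrow>
      p ! j < p ! i \<Longrightarrow> p ! i < p ! l \<Longrightarrow> p ! l < p ! k \<Longrightarrow> False"
  shows "(\<forall>i j k l. inversion p i j \<longrightarrow> inversion p k l \<longrightarrow> i < l) \<or>
    (\<forall>i j k l. inversion p i j \<longrightarrow> inversion p k l \<longrightarrow> p ! l < p ! i)"
proof (rule ccontr)
  assume "\<not> ?thesis"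
  then obtain t t\<^sub>b b b\<^sub>t t' t'\<^sub>b b' b'\<^sub>t where
    t: "inversion p t t\<^sub>b" and b: "inversion p b\<^sub>t b" and tb: "\<not> p ! b < p ! t"
    and t': "inversion p t' t'\<^sub>b" and b': "inversion p b'\<^sub>t b'" and tb': "\<not> t' < b'"
    by blast
  have neq: "p ! i \<noteq> p ! j" if "i < length p" "j < length p" "i \<noteq> j" for i j
    using that dist by (simp add: nth_eq_iff_index_eq)
  have lens: "t < length p" "b < length p" "t' < length p" "b' < length p"
    using t b t' b' by (auto simp: inversion_def)
  \<comment> \<open>A larger top to the left would form a 321 with the later top and the bottom of
    that top.\<close>
  have tops: "p ! i < p ! k" if "inversion p i j" "inversion p k l" "i < k" for i j k l
    using that no321[of i k l] neq[of i k] by (force simp: inversion_def)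
  have tops': "i < k" if "inversion p i j" "inversion p k l" "p ! i < p ! k" for i j k l
    using that tops[of k l i j] by (metis linorder_neqE_nat order.asym)
  have bots: "p ! j < p ! l" if "inversion p i j" "inversion p k l" "j < l" for i j k l
    using that no321[of i j l] neq[of j l] by (force simp: inversion_def)
  have bots': "j < l" if "inversion p i j" "inversion p k l" "p ! j < p ! l" for i j k l
    using that bots[of k l i j] by (metis linorder_neqE_nat order.asym)
  have disj: "i \<noteq> l" if "inversion p i j" "inversion p k l" for i j k l
    using that no321[of k l j] by auto
  have ptb: "p ! t < p ! b" using tb neq[of t b] disj[OF t b] lens by linarith
  have ttb: "b' < t'" using tb' disj[OF t' b'] by linarith
  have pos_tb: "t < b"
    using no321[OF b, of t] disj[OF t b] ptb lens by (force simp: inversion_def)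
  have val_tb: "p ! b' < p ! t'"
    using no321[OF b', of t'] neq[of b' t'] ttb lens by (force simp: inversion_def)
  consider "inversion p t b'" "inversion p t' b" | "\<not> inversion p t' b" | "\<not> inversion p t b'"
    by blast
  then show False
  proof cases
    case 1
    \<comment> \<open>The four entries themselves form the 2143, in the order \<open>t\<close>,
      \<open>b'\<close>, \<open>t'\<close>, \<open>b\<close>.\<close>
    then show False using no2143[of t b' t' b] ptb ttb by (auto simp: inversion_def)
  next
    case 2
    \<comment> \<open>In the remaining cases a single entry, \<open>t'\<close> or \<open>b\<close>
      here and \<open>b'\<close> or \<open>t\<close> below, separates two inversions: one lies to
      its left and below it, the other to its right and above it.\<close>
    then consider "p ! t' < p ! b" | "b < t'" "p ! b < p ! t'"
      using lens neq[of t' b] disj[OF t' b] by (fastforce simp: inversion_def)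
    then show False
    proof cases
      case 1
      then have "t' < b\<^sub>t" using tops'[OF t' b] b by (simp add: inversion_def)
      moreover have "p ! b'\<^sub>t < p ! t'" using tops[OF b' t'] b' ttb by (simp add: inversion_def)
      ultimately show False
        using no2143[of "b'\<^sub>t" b' "b\<^sub>t" b] 1 b b' ttb by (simp add: inversion_def)
    next
      case 2
      have "t\<^sub>b < b" using bots'[OF t b] t ptb by (simp add: inversion_def)
      moreover have "p ! b < p ! t'\<^sub>b" using bots[OF b t'] t' 2 by (simp add: inversion_def)
      ultimately show False
        using no2143[of t "t\<^sub>b" t' "t'\<^sub>b"] 2 t t' ptb by (simp add: inversion_def)
    qed
  next
    case 3
    then consider "p ! t < p ! b'" | "b' < t" "p ! b' < p ! t"
      using lens neq[of t b'] disj[OF t b'] by (fastforce simp: inversion_def)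
    then show False
    proof cases
      case 1
      then have "t\<^sub>b < b'" using bots'[OF t b'] t by (simp add: inversion_def)
      moreover have "p ! b' < p ! t'\<^sub>b" using bots[OF b' t'] t' ttb by (simp add: inversion_def)
      ultimately show False
        using no2143[of t "t\<^sub>b" t' "t'\<^sub>b"] 1 t t' ttb by (simp add: inversion_def)
    next
      case 2
      have "p ! b'\<^sub>t < p ! t" using tops[OF b' t] b' 2 by (simp add: inversion_def)
      moreover have "t < b\<^sub>t" using tops'[OF t b] b ptb by (simp add: inversion_def)
      ultimately show False
        using no2143[of "b'\<^sub>t" b' "b\<^sub>t" b] 2 b b' ptb by (simp add: inversion_def)
    qed
  qed
qed

text \<open>The letter of a value tells which piece holds it. Since \<open>m < length p\<close>, the
  final entry \<open>n\<close> lies in the second piece, and the word starts with 0.\<close>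

lemma increasing_pair_is_grass:
  assumes p: "p \<in> permutations_of_set {1..n}" "last p = n" and m: "m < length p"
    and inc: "sorted (take m p)" "sorted (drop m p)"
  shows "p \<in> grass ` zero_words n"
proof -
  have set: "set p = {1..n}" and dist: "distinct p" and len: "length p = n"
    using permutations_of_setD[OF p(1)] length_finite_permutations_of_set[OF p(1)] by auto
  define f :: "nat \<Rightarrow> bit" where "f v = (if v \<in> set (drop m p) then 0 else 1)" for v
  define w where "w = map f (rev [1..<Suc n])"
  have w: "length w = n" by (simp add: w_def)
  have letter: "w ! (n - v) = f v" if "v \<in> set [1..<Suc n]" for v
    using that by (auto simp: w_def rev_nth simp del: upt_Suc)
  have "n > 0" using m len by simp
  then have "n \<in> set (drop m p)" using m p(2) by (metis last_drop last_in_set drop_eq_Nil not_less)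
  then have "f n = 0" by (simp add: f_def)
  then have "w \<in> zero_words n" using letter[of n] w \<open>n > 0\<close> by (auto simp: zero_words_def hd_conv_nth)
  have td: "set (take m p) \<union> set (drop m p) = {1..n}" "set (take m p) \<inter> set (drop m p) = {}"
    using set dist by (metis append_take_drop_id set_append, metis append_take_drop_id distinct_append)
  have tk: "v \<in> set (take m p) \<longleftrightarrow> v \<in> {1..n} \<and> v \<notin> set (drop m p)"
    and dr: "v \<in> set (drop m p) \<Longrightarrow> v \<in> {1..n}" for v
    using td by blast+
  have "filter (\<lambda>v. w ! (n - v) = 1) [1..<Suc n] = take m p"
  proof (rule sorted_distinct_set_unique)
    show "set (filter (\<lambda>v. w ! (n - v) = 1) [1..<Suc n]) = set (take m p)"
      using tk dr letter by (auto simp: f_def simp del: upt_Suc split: if_splits)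
  qed (use inc dist in \<open>auto simp: sorted_wrt_filter simp del: upt_Suc\<close>)
  moreover have "filter (\<lambda>v. w ! (n - v) = 0) [1..<Suc n] = drop m p"
  proof (rule sorted_distinct_set_unique)
    have "v \<in> set (filter (\<lambda>v. w ! (n - v) = 0) [1..<Suc n]) \<longleftrightarrow> v \<in> set (drop m p)" for v
      using letter[of v] dr[of v] by (auto simp: f_def simp del: upt_Suc split: if_splits)
    then show "set (filter (\<lambda>v. w ! (n - v) = 0) [1..<Suc n]) = set (drop m p)" by blast
  qed (use inc dist in \<open>auto simp: sorted_wrt_filter simp del: upt_Suc\<close>)
  ultimately have "grass w = p" by (simp add: grass_def arrange_def w del: upt_Suc)
  then show ?thesis using \<open>w \<in> zero_words n\<close> by blast
qed

lemma avoiders_subset: "avoiders n \<subseteq> grass ` zero_words n \<union> inv_grass ` zero_words n"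
proof
  fix p assume "p \<in> avoiders n"
  then have p: "p \<in> permutations_of_set {1..n}" and ne: "p \<noteq> []" and last: "last p = n"
    and av: "circ_avoids p [1, 4, 3, 2]" by (auto simp: avoiders_def)
  have set: "set p = {1..n}" and dist: "distinct p" and len: "length p = n"
    using permutations_of_setD[OF p] length_finite_permutations_of_set[OF p] by auto
  have n: "n > 0" and pn: "p ! (n - 1) = n" using ne last len by (auto simp: last_conv_nth)
  have le: "p ! i \<le> n" if "i < n" for i using set nth_mem[of i p] that len by auto
  have less: "p ! i < n" if "i < n - 1" for i
    using le[of i] that dist pn len n by (metis diff_less le_neq_implies_less less_numeral_extra(1)
        less_trans nat_neq_iff nth_eq_iff_index_eq)
  \<comment> \<open>3214 takes its 4 from the final maximum, so that its avoidance excludes a linear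
    321; 2143 is excluded directly.\<close>
  have c: "[3, 2, 1, 4] \<in> circ [1, 4, 3, 2::nat]" "[2, 1, 4, 3] \<in> circ [1, 4, 3, 2::nat]"
    by (simp_all add: circ_code)
  have no321: False if "inversion p i j" "inversion p j k" for i j k
  proof -
    have ijk: "i < j" "j < k" "k < n" "p ! j < p ! i" "p ! k < p ! j"
      using that by (auto simp: inversion_def len)
    have "k \<noteq> n - 1"
    proof
      assume "k = n - 1"
      then show False using ijk less[of j] pn by simp
    qed
    then have "k < n - 1" using ijk by linarith
    moreover have "p ! i < n" using less[of i] ijk by linarith
    ultimately have "circ_contains p [1, 4, 3, 2]"
      using ijk len pn n
      by (intro circ_contains_indices[OF _ _ _ c(1), of "[i, j, k, n - 1]"])
        (auto simp: order_isomorphic_def less_Suc_eq numeral_eq_Suc)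
    then show False using av by blast
  qed
  have no2143: False if "i < j" "j < k" "k < l" "l < length p"
      "p ! j < p ! i" "p ! i < p ! l" "p ! l < p ! k" for i j k l
  proof -
    have "circ_contains p [1, 4, 3, 2]"
      using that
      by (intro circ_contains_indices[OF _ _ _ c(2), of "[i, j, k, l]"])
        (auto simp: order_isomorphic_def less_Suc_eq numeral_eq_Suc)
    then show False using av by blast
  qed
  have leq: "p ! i \<le> p ! j" if "i \<le> j" "j < n" "\<not> inversion p i j" for i j
    using that by (cases "i = j") (auto simp: inversion_def len)
  consider (position) "\<And>i j k l. inversion p i j \<Longrightarrow> inversion p k l \<Longrightarrow> i < l"
    | (val) "\<And>i j k l. inversion p i j \<Longrightarrow> inversion p k l \<Longrightarrow> p ! l < p ! i"
  proof -
    have "(\<forall>i j k l. inversion p i j \<longrightarrow> inversion p k l \<longrightarrow> i < l) \<or>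
      (\<forall>i j k l. inversion p i j \<longrightarrow> inversion p k l \<longrightarrow> p ! l < p ! i)"
    proof (rule inversion_dichotomy[OF dist])
      fix i j k assume "inversion p i j" "inversion p j k"
      then show False by (rule no321)
    next
      fix i j k l assume "i < j" "j < k" "k < l" "l < length p"
        "p ! j < p ! i" "p ! i < p ! l" "p ! l < p ! k"
      then show False by (rule no2143)
    qed
    then show ?thesis using that by blast
  qed
  then show "p \<in> grass ` zero_words n \<union> inv_grass ` zero_words n"
  proof cases
    case position
    obtain m where m: "m < n" "\<And>i j. inversion p i j \<Longrightarrow> i < m \<and> m \<le> j"
    proof (cases "\<exists>i j. inversion p i j")
      case True
      \<comment> \<open>The cut is placed before the first inversion bottom; in this case all
        inversion tops lie to its left.\<close>
      define m where "m = (LEAST j. \<exists>i. inversion p i j)"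
      obtain i where i: "inversion p i m"
        using LeastI_ex[of "\<lambda>j. \<exists>i. inversion p i j"] True m_def by blast
      have "m \<le> j" if "inversion p i j" for i j
        unfolding m_def by (rule Least_le) (use that in blast)
      moreover have "m < n" using i by (simp add: inversion_def len)
      ultimately show ?thesis using that[of m] position[OF _ i] by blast
    next
      case False
      then show ?thesis using that[of 0] n by blast
    qed
    have "sorted (take m p)"
      unfolding sorted_iff_nth_mono
    proof (intro allI impI)
      fix i j assume "i \<le> j" "j < length (take m p)"
      then have "p ! i \<le> p ! j" using leq[of i j] m(2)[of i j] by (auto simp: len)
      then show "take m p ! i \<le> take m p ! j" using \<open>i \<le> j\<close> \<open>j < _\<close> by simp
    qed
    moreover have "sorted (drop m p)"
      unfolding sorted_iff_nth_mono
    proof (intro allI impI)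
      fix i j assume "i \<le> j" "j < length (drop m p)"
      then have "m + j < n" by (simp add: len)
      then have "p ! (m + i) \<le> p ! (m + j)"
        using leq[of "m + i" "m + j"] m(2)[of "m + i" "m + j"] \<open>i \<le> j\<close> by auto
      then show "drop m p ! i \<le> drop m p ! j" using \<open>m + j < n\<close> by (simp add: len)
    qed
    ultimately show ?thesis using increasing_pair_is_grass[OF p last] m(1) len by blast
  next
    case val
    \<comment> \<open>Letter 1 marks the entries that do not exceed every inversion bottom. Here
      tops exceed all bottoms, so an inversion has letter 0 at its top and letter 1 at its
      bottom.\<close>
    define u :: "bit list" where
      "u = map (\<lambda>x. if \<exists>i j. inversion p i j \<and> x \<le> p ! j then 1 else 0) p"
    have u: "u ! i = 1 \<longleftrightarrow> (\<exists>k j. inversion p k j \<and> p ! i \<le> p ! j)" if "i < n" for i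
      using that by (simp add: u_def len)
    have "standardizes p u"
      unfolding standardizes_nth
    proof (intro conjI allI impI)
      show "length p = length u" by (simp add: u_def)
      fix i j assume ij: "i < j" "j < length u"
      then have ijn: "i < n" "j < n" by (simp_all add: u_def len)
      show "if u ! i = 0 \<and> u ! j = 1 then p ! j < p ! i else p ! i < p ! j"
      proof (cases "u ! i = 0 \<and> u ! j = 1")
        case True
        then have "\<not> (\<exists>k j. inversion p k j \<and> p ! i \<le> p ! j)" using u[OF ijn(1)] by simp
        then show ?thesis using True u[OF ijn(2)] by (auto simp: not_le intro: le_less_trans)
      next
        case False
        have "\<not> inversion p i j"
        proof
          assume inv: "inversion p i j"
          then have "u ! j = 1" using u[OF ijn(2)] by blast
          then have "u ! i = 1" using False by simp
          then show False using u[OF ijn(1)] val[OF inv] by (meson not_le)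
        qed
        then have "p ! i \<le> p ! j" using leq ij ijn by simp
        moreover have "p ! i \<noteq> p ! j" using dist ij ijn len by (simp add: nth_eq_iff_index_eq)
        ultimately show ?thesis using False by auto
      qed
    qed
    then have "p = inv_grass (rev u)" using standardizes_perm_eq p by blast
    moreover have "rev u \<in> zero_words n"
    proof -
      \<comment> \<open>The maximum is never an inversion bottom, so its letter, the last one of
        \<open>u\<close>, is 0.\<close>
      have "\<not> (\<exists>k j. inversion p k j \<and> n \<le> p ! j)"
      proof
        assume "\<exists>k j. inversion p k j \<and> n \<le> p ! j"
        then obtain k j where kj: "inversion p k j" "n \<le> p ! j" by blast
        then have "p ! k \<le> n" using le[of k] by (simp add: inversion_def len)
        then show False using kj by (simp add: inversion_def)
      qed
      then have "u ! (n - 1) \<noteq> 1" using u[of "n - 1"] n pn by simp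
      moreover have "u \<noteq> []" "length u = n" using ne by (simp_all add: u_def len)
      ultimately show ?thesis by (simp add: zero_words_def hd_rev last_conv_nth)
    qed
    ultimately show ?thesis by blast
  qed
qed

lemma avoiders_eq: "avoiders n = grass ` zero_words n \<union> inv_grass ` zero_words n"
proof
  have "grass w \<in> avoiders n" "inv_grass w \<in> avoiders n" if "w \<in> zero_words n" for w
  proof -
    have "w \<noteq> []" using that by (simp add: zero_words_def)
    then have "grass w \<noteq> []" "inv_grass w \<noteq> []" by (metis length_0_conv length_grass, metis length_0_conv length_inv_grass)
    then show "grass w \<in> avoiders n" "inv_grass w \<in> avoiders n"
      using that grass_perm[of w] inv_grass_perm[of w] last_grass last_inv_grass grass_avoids_1432 inv_grass_avoids_1432
      by (auto simp: avoiders_def zero_words_def)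
  qed
  then show "grass ` zero_words n \<union> inv_grass ` zero_words n \<subseteq> avoiders n" by blast
qed (rule avoiders_subset)

section \<open>Counting by representatives\<close>

lemma finite_avoiders [simp]: "finite (avoiders n)"
  by (rule finite_subset[of _ "permutations_of_set {1..n}"]) (auto simp: avoiders_def)

lemma rotation_ending_in_max:
  assumes "s \<in> permutations_of_set {1..n}" "n \<ge> 1"
  obtains p where "p \<in> circ s" "p \<noteq> []" "last p = n"
proof -
  have "n \<in> set s" using assms by (auto dest: permutations_of_setD(1))
  then obtain a b where "s = a @ n # b" by (meson split_list)
  then have "s = (a @ [n]) @ b" by simp
  then have "b @ a @ [n] \<in> circ s" using circ_append by metis
  then show ?thesis using that[of "b @ a @ [n]"] by simp
qed

text \<open>Every class has exactly one rotation ending in its maximum, so \<open>circ\<close> is a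
  bijection from these representatives.\<close>

lemma card_Av:
  assumes "n \<ge> 1"
  shows "card (Av n {[1, 4, 3, 2], q}) = card {p \<in> avoiders n. circ_avoids p q}"
proof -
  have "Av n {[1, 4, 3, 2], q} = circ ` {p \<in> avoiders n. circ_avoids p q}"
  proof (intro equalityI subsetI)
    fix c assume "c \<in> Av n {[1, 4, 3, 2], q}"
    then obtain s where s: "c = circ s" "s \<in> permutations_of_set {1..n}"
      "circ_avoids s [1, 4, 3, 2]" "circ_avoids s q" by (auto simp: Av_def)
    obtain p where p: "p \<in> circ s" "p \<noteq> []" "last p = n"
      using rotation_ending_in_max[OF s(2) assms] .
    have "circ p = circ s" using circ_in_circ[OF p(1)] .
    then have "p \<in> avoiders n" "circ_avoids p q"
      using s p circ_permutation[OF p(1) s(2)] circ_contains_cong[of p s] by (auto simp: avoiders_def)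
    then show "c \<in> circ ` {p \<in> avoiders n. circ_avoids p q}" using \<open>circ p = circ s\<close> s(1) by blast
  qed (auto simp: Av_def avoiders_def)
  moreover have "inj_on circ {p \<in> avoiders n. circ_avoids p q}"
  proof (rule inj_onI)
    fix p p' assume "p \<in> {p \<in> avoiders n. circ_avoids p q}" "p' \<in> {p \<in> avoiders n. circ_avoids p q}" "circ p = circ p'"
    then show "p = p'"
      using circ_last_unique[of p p'] self_in_circ[of p] permutations_of_setD(2) by (auto simp: avoiders_def)
  qed
  ultimately show ?thesis by (simp add: card_image)
qed

text \<open>Members containing the pattern are counted because, for the patterns counted below, they
  come from words with at least three runs, where \<open>grass\<close> and \<open>inv_grass\<close>
  are injective.\<close>

definition containers :: "nat \<Rightarrow> nat list \<Rightarrow> nat list set" where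
  "containers n q = {p \<in> avoiders n. circ_contains p q}"

lemma wilf_equivalent_containers:
  assumes "\<And>n. n \<ge> 1 \<Longrightarrow> card (containers n q) = card (containers n q')"
  shows "wilf_equivalent {[1, 4, 3, 2], q} {[1, 4, 3, 2], q'}"
  unfolding wilf_equivalent_def
proof (intro allI impI)
  fix n :: nat assume n: "n \<ge> 1"
  have "card {p \<in> avoiders n. circ_avoids p r} = card (avoiders n) - card (containers n r)" for r
  proof -
    have "{p \<in> avoiders n. circ_avoids p r} = avoiders n - containers n r" by (auto simp: containers_def)
    then show ?thesis by (simp add: card_Diff_subset containers_def)
  qed
  then show "card (Av n {[1, 4, 3, 2], q}) = card (Av n {[1, 4, 3, 2], q'})"
    using assms[OF n] card_Av[OF n] by simp
qed

lemma containers_circ: "circ q = circ q' \<Longrightarrow> containers n q = containers n q'"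
  using circ_contains_cong[OF refl, of q q'] by (simp add: containers_def)

section \<open>Containment in terms of words\<close>

lemma num_runs_complement [simp]: "num_runs (complement w) = num_runs w"
proof (induction w)
  case (Cons x w)
  then show ?case by (cases w) (auto simp: num_runs_Cons)
qed simp

lemma hd_complement: "w \<noteq> [] \<Longrightarrow> hd (complement w) = hd w + 1"
  by (cases w) auto

text \<open>Complementation brings \<open>v'\<close> to first letter 0. Then both permutations end
  in their maximum, so as rotations of each other they are equal, and injectivity applies.\<close>

lemma grass_in_circ_grass:
  assumes v: "hd v = 0" "num_runs v \<ge> 3"
  shows "grass v' \<in> circ (grass v) \<longleftrightarrow> v' = v \<or> v' = complement v"
proof
  have dist: "distinct (grass v)" using grass_perm[of v] by (auto dest: permutations_of_setD(2))
  have ne: "v \<noteq> []" using v by auto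
  have *: "u = v" if "grass u \<in> circ (grass v)" "u \<noteq> []" "hd u = 0" for u :: "bit list"
  proof -
    have "length u = length v"
      using length_circ[OF that(1)] by simp
    then have "grass u = grass v"
      using circ_last_unique[OF that(1) dist] last_grass that(2,3) ne v(1) by simp
    then show ?thesis using grass_inj[OF v] by metis
  qed
  assume v': "grass v' \<in> circ (grass v)"
  then have "v' \<noteq> []" using ne length_circ[OF v'] by auto
  show "v' = v \<or> v' = complement v"
  proof (cases "hd v' = 0")
    case False
    then have "hd (complement v') = 0" using \<open>v' \<noteq> []\<close> by (simp add: hd_complement)
    moreover have "grass (complement v') \<in> circ (grass v)" using grass_complement[of v'] circ_in_circ[OF v'] by simp
    ultimately show ?thesis using *[of "complement v'"] \<open>v' \<noteq> []\<close> complement_simps(4,7) by metis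
  qed (use * v' \<open>v' \<noteq> []\<close> in blast)
qed (use self_in_circ grass_complement in auto)

lemma inv_grass_in_circ_inv_grass:
  assumes v: "hd v = 0" "num_runs v \<ge> 3"
  shows "inv_grass v' \<in> circ (inv_grass v) \<longleftrightarrow> (\<exists>j u. v' = replicate j 1 @ u \<and> v = u @ replicate j 0)"
proof
  have dist: "distinct (inv_grass v)" using inv_grass_perm[of v] by (auto dest: permutations_of_setD(2))
  have ne: "v \<noteq> []" using v by auto
  assume v': "inv_grass v' \<in> circ (inv_grass v)"
  \<comment> \<open>Trading all leading 1s of \<open>v'\<close> for trailing 0s is a rotation and
    yields a word with first letter 0, which must be \<open>v\<close>.\<close>
  define j u where "j = length (takeWhile (\<lambda>x. x = 1) v')" and "u = dropWhile (\<lambda>x. x = 1) v'"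
  have "takeWhile (\<lambda>x. x = 1) v' = replicate j 1"
    unfolding j_def by (rule replicate_eqI) (auto dest: set_takeWhileD)
  then have vv': "v' = replicate j 1 @ u" unfolding u_def by (metis takeWhile_dropWhile_id)
  have "length v' = length v"
    using length_circ[OF v'] by simp
  then have len: "length (u @ replicate j 0) = length v" by (simp add: vv')
  have c: "inv_grass (u @ replicate j 0) \<in> circ (inv_grass v)"
    using inv_grass_rotate[of u j] circ_in_circ[OF v'] vv' by simp
  have "u \<noteq> [] \<Longrightarrow> hd u = 0"
    using hd_dropWhile[of "\<lambda>x. x = 1" v'] by (simp add: u_def)
  moreover have uj: "u @ replicate j 0 \<noteq> []" using len ne by auto
  \<comment> \<open>If \<open>v'\<close> consists of 1s only, \<open>u\<close> is empty and the
    first letter comes from the padding.\<close>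
  ultimately have "hd (u @ replicate j 0) = 0" by (cases u; cases j) auto
  then have "inv_grass (u @ replicate j 0) = inv_grass v"
    using circ_last_unique[OF c dist] last_inv_grass[OF uj] last_inv_grass[OF ne v(1)] len by simp
  then have "v = u @ replicate j 0" using inv_grass_inj[OF v] by metis
  then show "\<exists>j u. v' = replicate j 1 @ u \<and> v = u @ replicate j 0" using vv' by blast
next
  assume "\<exists>j u. v' = replicate j 1 @ u \<and> v = u @ replicate j 0"
  then show "inv_grass v' \<in> circ (inv_grass v)" using inv_grass_rotate circ_sym by blast
qed

lemma grass_contains_grass:
  assumes v: "hd v = 0" "num_runs v \<ge> 3"
  shows "circ_contains (grass w) (grass v) \<longleftrightarrow> subseq v w \<or> subseq (complement v) w"
  unfolding circ_contains_grass[OF grass_perm[of v]] grass_in_circ_grass[OF v] by metis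

lemma inv_grass_contains_inv_grass:
  assumes v: "hd v = 0" "num_runs v \<ge> 3"
  shows "circ_contains (inv_grass w) (inv_grass v) \<longleftrightarrow>
    (\<exists>j u. subseq (replicate j 1 @ u) w \<and> v = u @ replicate j 0)"
  unfolding circ_contains_inv_grass[OF inv_grass_perm[of v]] inv_grass_in_circ_inv_grass[OF v] by metis

lemma inv_grass_not_contains_grass: "hd v = 0 \<Longrightarrow> num_runs v \<ge> 5 \<Longrightarrow> circ_avoids (inv_grass w) (grass v)"
  using circ_contains_trans grass_contains_24135 inv_grass_avoids_24135 by blast

lemma grass_not_contains_inv_grass: "hd v = 0 \<Longrightarrow> num_runs v \<ge> 5 \<Longrightarrow> circ_avoids (grass w) (inv_grass v)"
  using circ_contains_trans inv_grass_contains_31425 grass_avoids_31425 by blast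

lemma finite_zero_words [simp]: "finite (zero_words n)"
proof (rule finite_subset)
  have "x \<in> {0, 1}" for x :: bit by (cases x) auto
  then show "zero_words n \<subseteq> {w. set w \<subseteq> {0, 1} \<and> length w = n}" by (auto simp: zero_words_def)
qed (simp add: finite_lists_length_eq)

lemma inj_on_grass: "inj_on grass {w \<in> zero_words n. num_runs w \<ge> 3}"
  by (rule inj_onI, rule grass_inj) (simp_all add: zero_words_def)

lemma inj_on_inv_grass: "inj_on inv_grass {w \<in> zero_words n. num_runs w \<ge> 3}"
  by (rule inj_onI, rule inv_grass_inj) (simp_all add: zero_words_def)

lemma card_containers_grass:
  assumes v: "hd v = 0" "num_runs v \<ge> 5"
  shows "card (containers n (grass v)) = card {w \<in> zero_words n. subseq v w \<or> subseq (complement v) w}"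
proof -
  have "circ_contains (grass w) (grass v) \<longleftrightarrow> subseq v w \<or> subseq (complement v) w" for w
    using grass_contains_grass v by simp
  then have "containers n (grass v) = grass ` {w \<in> zero_words n. subseq v w \<or> subseq (complement v) w}"
    using inv_grass_not_contains_grass[OF v] unfolding containers_def avoiders_eq by blast
  moreover have "{w \<in> zero_words n. subseq v w \<or> subseq (complement v) w} \<subseteq> {w \<in> zero_words n. num_runs w \<ge> 3}"
  proof
    fix w assume "w \<in> {w \<in> zero_words n. subseq v w \<or> subseq (complement v) w}"
    then have "w \<in> zero_words n" "num_runs v \<le> num_runs w"
      using num_runs_subseq[of v w] num_runs_subseq[of "complement v" w] by auto
    then show "w \<in> {w \<in> zero_words n. num_runs w \<ge> 3}" using v by simp
  qed
  ultimately show ?thesis using inj_on_subset[OF inj_on_grass] by (simp add: card_image)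
qed

lemma num_runs_append_replicate: "num_runs (u @ replicate j a) \<le> Suc (num_runs u)"
proof (induction u)
  case Nil
  then show ?case by (simp add: num_runs_def remdups_adj_replicate)
next
  case (Cons b u)
  then show ?case by (cases "u = []"; cases j) (auto simp: num_runs_Cons)
qed

lemma card_containers_inv_grass:
  assumes v: "hd v = 0" "num_runs v \<ge> 5"
  shows "card (containers n (inv_grass v)) =
    card {w \<in> zero_words n. \<exists>j u. subseq (replicate j 1 @ u) w \<and> v = u @ replicate j 0}"
proof -
  have c: "circ_contains (inv_grass w) (inv_grass v) \<longleftrightarrow>
    (\<exists>j u. subseq (replicate j 1 @ u) w \<and> v = u @ replicate j 0)" for w
    by (rule inv_grass_contains_inv_grass) (use v in simp_all)
  have "containers n (inv_grass v) = inv_grass ` {w \<in> zero_words n. circ_contains (inv_grass w) (inv_grass v)}"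
    using grass_not_contains_inv_grass[OF v] unfolding containers_def avoiders_eq by blast
  moreover have runs: "num_runs w \<ge> 3" if w: "w \<in> zero_words n" "circ_contains (inv_grass w) (inv_grass v)" for w
  proof -
    obtain j u where u: "subseq (replicate j 1 @ u) w" "v = u @ replicate j 0"
      using w(2)[unfolded c] by (elim exE conjE)
    \<comment> \<open>Removing trailing 0s from \<open>v\<close> costs at most one run, so the
      embedded \<open>u\<close> still has at least four.\<close>
    have "num_runs v \<le> Suc (num_runs u)" using u(2) num_runs_append_replicate by metis
    moreover have "num_runs u \<le> num_runs w"
      using num_runs_subseq[OF subseq_order.order_trans[OF subseq_drop_many[OF subseq_order.order_refl] u(1)]] .
    ultimately show ?thesis using v by linarith
  qed
  moreover have "inj_on inv_grass {w \<in> zero_words n. circ_contains (inv_grass w) (inv_grass v)}"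
    by (rule inj_on_subset[OF inj_on_inv_grass]) (use runs in blast)
  ultimately have "card (containers n (inv_grass v)) = card {w \<in> zero_words n. circ_contains (inv_grass w) (inv_grass v)}"
    by (simp add: card_image)
  then show ?thesis by (simp only: c)
qed

section \<open>Counting words that contain a given word\<close>

definition words :: "nat \<Rightarrow> bit list set" where
  "words n = {w. length w = n}"

lemma finite_words [simp]: "finite (words n)"
proof (rule finite_subset)
  have "x \<in> {0, 1}" for x :: bit by (cases x) auto
  then show "words n \<subseteq> {w. set w \<subseteq> {0, 1} \<and> length w = n}" by (auto simp: words_def)
qed (simp add: finite_lists_length_eq)

lemma words_Suc: "words (Suc n) = (#) x ` words n \<union> (#) (x + 1) ` words n"
proof (intro equalityI subsetI)
  fix w assume "w \<in> words (Suc n)"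
  then obtain y u where "w = y # u" "u \<in> words n" by (cases w) (auto simp: words_def)
  then show "w \<in> (#) x ` words n \<union> (#) (x + 1) ` words n" by (cases x; cases y) auto
qed (auto simp: words_def)

text \<open>The first letter of \<open>w\<close> either matches the first letter sought or is
  skipped. This gives a recursion for the count in which only the length of \<open>v\<close>
  enters.\<close>

lemma card_words_subseq_cong:
  "length v = length v' \<Longrightarrow> card {w \<in> words n. subseq v w} = card {w \<in> words n. subseq v' w}"
proof (induction n arbitrary: v v')
  case 0
  then show ?case by (cases v; cases v') (simp_all add: words_def cong: conj_cong)
next
  case (Suc n)
  have rec: "card {w \<in> words (Suc n). subseq (x # u) w} =
      card {w \<in> words n. subseq u w} + card {w \<in> words n. subseq (x # u) w}" for x u
  proof -
    have "{w \<in> words (Suc n). subseq (x # u) w} =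
        (#) x ` {w \<in> words n. subseq u w} \<union> (#) (x + 1) ` {w \<in> words n. subseq (x # u) w}"
      unfolding words_Suc[of n x] by (cases x) auto
    moreover have "(#) x ` A \<inter> (#) (x + 1) ` A' = {}" for A A' by (cases x) auto
    ultimately show ?thesis by (simp add: card_Un_disjoint card_image)
  qed
  show ?case
  proof (cases v)
    case Nil
    then show ?thesis using Suc.prems by simp
  next
    case (Cons x u)
    then obtain x' u' where "v' = x' # u'" "length u = length u'" using Suc.prems by (cases v') auto
    then show ?thesis using rec Cons Suc.IH[of u u'] Suc.IH[of v v'] by simp
  qed
qed

lemma zero_words_0: "zero_words 0 = {}"
  by (auto simp: zero_words_def)

lemma card_zero_words_subseq_cong:
  assumes "v \<noteq> []" "hd v = 0" "v' \<noteq> []" "hd v' = 0" "length v = length v'"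
  shows "card {w \<in> zero_words n. subseq v w} = card {w \<in> zero_words n. subseq v' w}"
proof (cases n)
  case (Suc m)
  have "card {w \<in> zero_words n. subseq u w} = card {w \<in> words m. subseq (tl u) w}" if "u \<noteq> []" "hd u = 0" for u
  proof -
    \<comment> \<open>Matching the leading 0 of the pattern with the leading 0 of the word removes
      the condition on the first letter.\<close>
    have "{w \<in> zero_words n. subseq u w} = (#) 0 ` {w \<in> words m. subseq (tl u) w}"
    proof (intro equalityI subsetI)
      fix w assume "w \<in> {w \<in> zero_words n. subseq u w}"
      then show "w \<in> (#) 0 ` {w \<in> words m. subseq (tl u) w}"
        using that by (cases w; cases u) (auto simp: zero_words_def words_def Suc)
    qed (use that in \<open>cases u; auto simp: zero_words_def words_def Suc\<close>)
    then show ?thesis by (simp add: card_image)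
  qed
  then show ?thesis using assms card_words_subseq_cong[of "tl v" "tl v'" m] by simp
qed (simp add: zero_words_0)

section \<open>Words containing a word or its complement\<close>

definition has_word :: "bit list \<Rightarrow> bit list \<Rightarrow> bool" where
  "has_word v w \<longleftrightarrow> subseq v w \<or> subseq (complement v) w"

lemma has_word_complement [simp]: "has_word (complement v) w = has_word v w" "has_word v (complement w) = has_word v w"
  using subseq_complement[of v w] subseq_complement[of "complement v" w] by (auto simp: has_word_def)

lemma has_word_rev [simp]: "has_word (rev v) (rev w) = has_word v w"
  by (simp add: has_word_def subseq_rev_iff)

text \<open>All words are counted, since reversal does not preserve the first letter; complementing
  pairs the words starting with 0 with the others.\<close>

definition count_words :: "bit list \<Rightarrow> nat \<Rightarrow> nat" where
  "count_words v n = card {w \<in> words n. has_word v w}"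

lemma count_words_complement [simp]: "count_words (complement v) n = count_words v n"
  by (simp add: count_words_def)

lemma count_words_rev [simp]: "count_words (rev v) n = count_words v n"
proof -
  have "bij_betw rev {w \<in> words n. has_word v w} {w \<in> words n. has_word (rev v) w}"
  proof (rule bij_betwI[of rev _ _ rev])
    have "has_word v (rev w) = has_word (rev v) w" for w
      using has_word_rev[of v "rev w"] by simp
    then show "rev \<in> {w \<in> words n. has_word (rev v) w} \<rightarrow> {w \<in> words n. has_word v w}"
      by (simp add: words_def)
  qed (auto simp: words_def)
  then show ?thesis by (simp add: count_words_def bij_betw_same_card)
qed

lemma count_words_zero_words: "n \<ge> 1 \<Longrightarrow> count_words v n = 2 * card {w \<in> zero_words n. has_word v w}"
proof -
  assume n: "n \<ge> 1"
  let ?A = "{w \<in> zero_words n. has_word v w}"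
  have "{w \<in> words n. has_word v w} = ?A \<union> complement ` ?A"
  proof (intro equalityI subsetI)
    fix w assume w: "w \<in> {w \<in> words n. has_word v w}"
    then have ne: "w \<noteq> []" using n by (auto simp: words_def)
    show "w \<in> ?A \<union> complement ` ?A"
    proof (cases "hd w = 0")
      case True
      then show ?thesis using w ne by (simp add: zero_words_def words_def)
    next
      case False
      then have "complement w \<in> ?A" using w ne by (simp add: zero_words_def words_def hd_complement)
      then have "complement (complement w) \<in> complement ` ?A" by (rule imageI)
      then show ?thesis by simp
    qed
  qed (auto simp: zero_words_def words_def)
  moreover have "?A \<inter> complement ` ?A = {}"
  proof -
    have False if x: "x \<in> ?A" "x \<in> complement ` ?A" for x
    proof -
      obtain u where u: "u \<in> ?A" "x = complement u" using x(2) by (elim imageE)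
      then have "hd x = 1" using hd_complement[of u] by (simp add: zero_words_def)
      moreover have "hd x = 0" using x(1) by (simp add: zero_words_def)
      ultimately show False by simp
    qed
    then show ?thesis by (intro equals0I) (elim IntE)
  qed
  moreover have "inj_on complement ?A" by (rule inj_on_inverseI[of _ complement]) simp
  ultimately show ?thesis by (simp add: count_words_def card_Un_disjoint card_image)
qed

lemma card_zero_words_has_word_cong:
  "count_words v n = count_words v' n \<Longrightarrow> card {w \<in> zero_words n. has_word v w} = card {w \<in> zero_words n. has_word v' w}"
  using count_words_zero_words[of n v] count_words_zero_words[of n v'] by (cases "n = 0") (simp_all add: zero_words_0)

text \<open>A word contains \<open>x y u\<close> or its complement, where \<open>x \<noteq> y\<close>, iff the word without its first
  run contains \<open>y u\<close> or its complement. The recursion peels off that run letter by letter.\<close>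

lemma has_word_alternate:
  assumes "v \<noteq> []"
  shows "has_word ((hd v + 1) # v) (c # d # w) \<longleftrightarrow>
    (if c = d then has_word ((hd v + 1) # v) (d # w) else has_word v (d # w))"
proof -
  obtain x u where "v = x # u" using assms by (cases v) auto
  then show ?thesis
    by (cases x; cases c; cases d) (simp_all add: has_word_def)
qed

lemma count_words_alternate:
  assumes "v \<noteq> []"
  shows "count_words ((hd v + 1) # v) (Suc (Suc n)) =
    count_words ((hd v + 1) # v) (Suc n) + count_words v (Suc n)"
proof -
  let ?v = "(hd v + 1) # v"
  let ?A = "{w \<in> words (Suc n). has_word ?v w}" and ?B = "{w \<in> words (Suc n). has_word v w}"
  \<comment> \<open>A word of length at least two arises from its tail by repeating the first letter
    of the tail or by prepending the opposite one, which opens a new run.\<close>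
  have "{w \<in> words (Suc (Suc n)). has_word ?v w} = (\<lambda>t. hd t # t) ` ?A \<union> (\<lambda>t. (hd t + 1) # t) ` ?B"
    (is "?L = ?R")
  proof (intro equalityI subsetI)
    fix w assume w: "w \<in> ?L"
    then obtain c d u where cdu: "w = c # d # u" by (auto simp: words_def length_Suc_conv)
    show "w \<in> ?R"
    proof (cases "c = d")
      case True
      then have "d # u \<in> ?A" "w = hd (d # u) # d # u"
        using w has_word_alternate[OF assms, of c d u] by (auto simp: cdu words_def)
      then show ?thesis by blast
    next
      case False
      then have "c = d + 1" by (cases c; cases d) auto
      then have "d # u \<in> ?B" "w = (hd (d # u) + 1) # d # u"
        using w has_word_alternate[OF assms, of c d u] False by (auto simp: cdu words_def)
      then show ?thesis by blast
    qed
  next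
    fix w assume "w \<in> ?R"
    then consider t where "t \<in> ?A" "w = hd t # t" | t where "t \<in> ?B" "w = (hd t + 1) # t" by blast
    then show "w \<in> ?L"
    proof cases
      case 1
      then show ?thesis using has_word_alternate[OF assms, of "hd t" "hd t" "tl t"]
        by (cases t) (auto simp: words_def)
    next
      case 2
      then show ?thesis using has_word_alternate[OF assms, of "hd t + 1" "hd t" "tl t"]
        by (cases t; cases "hd t") (auto simp: words_def)
    qed
  qed
  moreover have "(\<lambda>t. hd t # t) ` ?A \<inter> (\<lambda>t. (hd t + 1) # t) ` ?B = {}"
  proof -
    have "x \<noteq> x + 1" for x :: bit by (cases x) auto
    then show ?thesis by auto
  qed
  moreover have "inj_on (\<lambda>t. hd t # t) ?A" "inj_on (\<lambda>t. (hd t + 1) # t) ?B"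
    by (auto intro: inj_onI)
  ultimately show ?thesis by (simp add: count_words_def card_Un_disjoint card_image)
qed

lemma count_words_alternate_cong:
  assumes "v \<noteq> []" "v' \<noteq> []" "\<And>n. count_words v n = count_words v' n"
  shows "count_words ((hd v + 1) # v) n = count_words ((hd v' + 1) # v') n"
proof (induction n rule: induct_nat_012)
  case (ge2 n)
  then show ?case
    unfolding count_words_alternate[OF assms(1)] count_words_alternate[OF assms(2)]
    using assms(3) by (simp only:)
next
  case 0
  have "{w \<in> words 0. has_word (x # u) w} = {}" for x u by (auto simp: words_def has_word_def)
  then have "count_words (x # u) 0 = 0" for x u by (simp only: count_words_def card.empty)
  then show ?case by (simp only:)
next
  case 1
  \<comment> \<open>The recursion starts at length two; a single letter cannot contain a pattern of
    length at least two.\<close>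
  have "count_words (x # u) (Suc 0) = 0" if "u \<noteq> []" for x u
  proof -
    have "{w \<in> words (Suc 0). has_word (x # u) w} = {}"
      using that by (auto simp: words_def has_word_def)
    then show ?thesis by (simp only: count_words_def card.empty)
  qed
  then show ?case using assms(1,2) by (simp only: not_False_eq_True)
qed

section \<open>Compositions\<close>

lemma composition_simps [simp]:
  "composition []" "composition (n # ns) \<longleftrightarrow> n > 0 \<and> composition ns"
  "composition (ns @ ms) \<longleftrightarrow> composition ns \<and> composition ms"
  "composition (rev ns) \<longleftrightarrow> composition ns" "composition (replicate k (Suc 0))"
  by (auto simp: composition_def)

lemma blocks_append:
  "blocks x (ns @ ms) = blocks x ns @ blocks (if even (length ns) then x else x + 1) ms"
  by (induction ns arbitrary: x) auto

lemma complement_replicate [simp]: "complement (replicate n x) = replicate n (x + 1)"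
  by (simp add: complement_def)

lemma complement_blocks [simp]: "complement (blocks x ns) = blocks (x + 1) ns"
  by (induction ns arbitrary: x) auto

lemma length_blocks [simp]: "length (blocks x ns) = sum_list ns"
  by (induction ns arbitrary: x) auto

lemma blocks_Nil_iff: "composition ns \<Longrightarrow> blocks x ns = [] \<longleftrightarrow> ns = []"
  by (cases ns) auto

lemma hd_blocks: "composition ns \<Longrightarrow> ns \<noteq> [] \<Longrightarrow> hd (blocks x ns) = x"
  by (cases ns) (auto simp: hd_append)

lemma num_runs_replicate_append:
  "n > 0 \<Longrightarrow> num_runs (replicate n x @ w) = num_runs w + (if w = [] \<or> hd w \<noteq> x then 1 else 0)"
proof (induction n)
  case (Suc n)
  then show ?case by (cases "n = 0") (auto simp: num_runs_Cons hd_append)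
qed simp

lemma num_runs_blocks: "composition ns \<Longrightarrow> num_runs (blocks x ns) = length ns"
proof (induction ns arbitrary: x)
  case (Cons n ns)
  have "x + 1 \<noteq> x" by (cases x) auto
  then show ?case using Cons hd_blocks[of ns "x + 1"] blocks_Nil_iff[of ns "x + 1"]
      num_runs_replicate_append[of n x "[]"]
    by (cases "ns = []") (simp_all add: num_runs_replicate_append)
qed simp

text \<open>The first letter \<open>y\<close> varies with the parity of the number of blocks; counts
  invariant under complement absorb this.\<close>

lemma rev_blocks: "\<exists>y. rev (blocks x ns) = blocks y (rev ns)"
proof (induction ns arbitrary: x)
  case (Cons n ns)
  define y where "y = (if even (length ns) then x else x + 1)"
  have "rev (blocks x' ns) = blocks (if even (length ns) then x' + 1 else x') (rev ns)" for x'
  proof (induction ns arbitrary: x')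
    case (Cons m ms)
    then show ?case by (simp add: blocks_append)
  qed simp
  then show ?case by (auto simp: blocks_append)
qed simp

lemma word_blocks:
  "w \<noteq> [] \<Longrightarrow> \<exists>ns. composition ns \<and> ns \<noteq> [] \<and> w = blocks (hd w) ns"
proof (induction w)
  case (Cons x w)
  show ?case
  proof (cases "w = []")
    case True
    then show ?thesis by (intro exI[of _ "[1]"]) simp
  next
    case False
    then obtain ns where ns: "composition ns" "ns \<noteq> []" "w = blocks (hd w) ns" using Cons.IH by blast
    show ?thesis
    proof (cases "hd w = x")
      case True
      obtain m ms where "ns = m # ms" using ns by (cases ns) auto
      then show ?thesis using ns True by (intro exI[of _ "Suc m # ms"]) simp
    next
      case False
      then have "hd w = x + 1" by (cases x; cases "hd w") auto
      then show ?thesis using ns by (intro exI[of _ "1 # ns"]) simp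
    qed
  qed
qed simp

lemma word_B:
  assumes "w \<noteq> []" "hd w = 0"
  obtains ns where "composition ns" "ns \<noteq> []" "w = B ns"
  using word_blocks[OF assms(1)] assms(2) that by (auto simp: B_def)

lemma num_runs_B: "composition ns \<Longrightarrow> num_runs (B ns) = length ns"
  by (simp add: B_def num_runs_blocks)

lemma hd_B: "composition ns \<Longrightarrow> ns \<noteq> [] \<Longrightarrow> hd (B ns) = 0"
  by (simp add: B_def hd_blocks)

lemma B_Nil_iff: "composition ns \<Longrightarrow> B ns = [] \<longleftrightarrow> ns = []"
  by (simp add: B_def blocks_Nil_iff)

lemma length_B: "length (B ns) = sum_list ns"
  by (simp add: B_def)

lemma distinct_adj_B:
  assumes "composition ns"
  shows "distinct_adj (B ns) \<longleftrightarrow> ns = replicate (length ns) 1"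
proof -
  have "distinct_adj w \<longleftrightarrow> num_runs w = length w" for w
    by (simp add: num_runs_def distinct_adj_conv_length_remdups_adj)
  moreover have "length ns = sum_list ns \<longleftrightarrow> ns = replicate (length ns) 1"
    using assms
  proof (induction ns)
    case (Cons n ns)
    have "length ns \<le> sum_list ns" using Cons.prems by (induction ns) auto
    then show ?case using Cons by (cases n) auto
  qed simp
  ultimately show ?thesis using assms by (simp add: num_runs_B length_B)
qed

section \<open>Moving runs of length 1\<close>

lemma count_words_B_rev: "count_words (B (rev ns)) n = count_words (B ns) n"
proof -
  obtain y where "rev (B ns) = blocks y (rev ns)" using rev_blocks unfolding B_def by blast
  then have "B (rev ns) = rev (B ns) \<or> B (rev ns) = complement (rev (B ns))"
    by (cases y) (auto simp: B_def simp del: complement_simps(6))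
  then show ?thesis by (metis count_words_complement count_words_rev)
qed

lemma count_words_B_Cons_cong:
  assumes "composition ns" "composition ms" "ns \<noteq> []" "ms \<noteq> []"
    and "\<And>n. count_words (B ns) n = count_words (B ms) n"
  shows "count_words (B (1 # ns)) n = count_words (B (1 # ms)) n"
proof -
  have "count_words (B (1 # ks)) n = count_words ((hd (B ks) + 1) # B ks) n"
    if "composition ks" "ks \<noteq> []" for ks
  proof -
    \<comment> \<open>Up to complement, a leading part 1 prepends to \<open>B ks\<close> the letter
      opposite to its first one.\<close>
    have "complement (B (1 # ks)) = (hd (B ks) + 1) # B ks" using that by (simp add: B_def hd_blocks)
    then show ?thesis by (metis count_words_complement)
  qed
  then show ?thesis
    using assms count_words_alternate_cong[of "B ns" "B ms" n] by (simp add: B_Nil_iff)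
qed

text \<open>Reversal turns the final 1 into a leading one; behind it \<open>rev ns\<close> may be
  replaced by \<open>ns\<close>, as the two have equal counts.\<close>

lemma count_words_B_snoc:
  assumes "composition ns" "ns \<noteq> []"
  shows "count_words (B (ns @ [1])) n = count_words (B (1 # ns)) n"
  using count_words_B_rev[of "ns @ [1]" n] assms
    count_words_B_Cons_cong[of "rev ns" ns n] by (simp add: count_words_B_rev)

lemma count_words_B_ones_cong:
  assumes "composition ns" "composition ms" "ns \<noteq> []" "ms \<noteq> []"
    and "\<And>n. count_words (B ns) n = count_words (B ms) n"
  shows "count_words (B (replicate k 1 @ ns)) n = count_words (B (replicate k 1 @ ms)) n"
proof (induction k arbitrary: n)
  case (Suc k)
  then show ?case
    using assms count_words_B_Cons_cong[of "replicate k 1 @ ns" "replicate k 1 @ ms" n] by simp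
qed (use assms in simp)

lemma count_words_B_ones:
  assumes "composition ns" "ns \<noteq> []"
  shows "count_words (B (ns @ replicate k 1)) n = count_words (B (replicate k 1 @ ns)) n"
proof (induction k arbitrary: n)
  case (Suc k)
  have "count_words (B (ns @ replicate (Suc k) 1)) n = count_words (B ((ns @ replicate k 1) @ [1])) n"
    by (simp add: replicate_append_same)
  also have "\<dots> = count_words (B (1 # ns @ replicate k 1)) n"
    using assms count_words_B_snoc[of "ns @ replicate k 1"] by simp
  also have "\<dots> = count_words (B (1 # replicate k 1 @ ns)) n"
    using assms Suc count_words_B_Cons_cong[of "ns @ replicate k 1" "replicate k 1 @ ns" n] by simp
  finally show ?case by simp
qed simp

lemma count_words_B_move_ones:
  assumes "composition ms" "ms \<noteq> []"
  shows "count_words (B (replicate s 1 @ ms @ replicate r 1)) n = count_words (B (ms @ replicate (s + r) 1)) n"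
proof -
  have "count_words (B (replicate s 1 @ ms @ replicate r 1)) n =
      count_words (B (replicate s 1 @ replicate r 1 @ ms)) n"
    using assms by (intro count_words_B_ones_cong count_words_B_ones) auto
  also have "\<dots> = count_words (B (ms @ replicate (s + r) 1)) n"
    using count_words_B_ones[OF assms, of "s + r"] by (simp add: replicate_add)
  finally show ?thesis .
qed

text \<open>Reversing the whole composition puts the 1s in front, and moving them back to the end
  leaves just \<open>ms\<close> reversed.\<close>

lemma count_words_B_rev_ones:
  assumes "composition ms" "ms \<noteq> []"
  shows "count_words (B (rev ms @ replicate r 1)) n = count_words (B (ms @ replicate r 1)) n"
  using count_words_B_rev[of "ms @ replicate r 1" n] count_words_B_ones[of "rev ms" r n] assms by simp

section \<open>Alternating words\<close>

text \<open>The complement starts with 1 and embeds behind the leading 0 of \<open>w\<close>.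
  Together with that 0 it is the alternating word one letter longer, of which the desired word is a
  prefix.\<close>

lemma zero_words_subseq_alternating:
  assumes "w \<in> zero_words n" "has_word (B (replicate k 1)) w"
  shows "subseq (B (replicate k 1)) w"
proof (cases "subseq (B (replicate k 1)) w")
  case False
  obtain u where w: "w = 0 # u" using assms(1) by (cases w) (auto simp: zero_words_def)
  have "subseq (blocks 1 (replicate k 1)) w" using False assms(2) by (simp add: has_word_def B_def)
  then have "subseq (blocks 1 (replicate k 1)) u" by (cases k) (auto simp: w)
  then have "subseq (B (replicate (Suc k) 1)) w" by (simp add: B_def w)
  moreover have "subseq (B (replicate k 1)) (B (replicate (Suc k) 1))"
    unfolding replicate_append_same[symmetric] replicate_Suc B_def blocks_append
    by (rule subseq_rev_drop_many) simp
  ultimately show ?thesis using subseq_order.order_trans by blast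
qed

section \<open>Words with at most four runs\<close>

lemma subseq_blocks_mono: "list_all2 (\<le>) ns ms \<Longrightarrow> subseq (blocks x ns) (blocks x ms)"
proof (induction arbitrary: x rule: list_all2_induct)
  case (Cons n ns m ms)
  have "replicate m x = replicate n x @ replicate (m - n) x"
    using Cons by (simp flip: replicate_add)
  then have "subseq (replicate n x) (replicate m x)" by (simp add: subseq_rev_drop_many)
  then show ?case using Cons by (auto intro: list_emb_append_mono)
qed simp

text \<open>The embedded word has at least as many runs as the host, so no run can be skipped and
  each block has to fit into the block at the same place.\<close>

lemma subseq_blocks_imp_le:
  assumes "subseq (blocks x ns) (blocks x ms)" "composition ns" "composition ms"
    "length ms \<le> length ns"
  shows "list_all2 (\<le>) ns ms"
  using assms
proof (induction ns arbitrary: ms x)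
  case (Cons n ns)
  have len: "length (n # ns) \<le> length ms"
    using num_runs_subseq[OF Cons.prems(1)] Cons.prems num_runs_blocks by metis
  then obtain m ms' where ms: "ms = m # ms'" by (cases ms) auto
  have x: "x + 1 \<noteq> x" by (cases x) auto
  have s: "subseq (replicate n x @ blocks (x + 1) ns) (replicate m x @ blocks (x + 1) ms')"
    using Cons.prems(1) ms by simp
  have drop: "subseq u w" if "subseq u (replicate k x @ w)" "u = [] \<or> hd u \<noteq> x" for u w k
    using that by (induction k) (cases u; auto)+
  show ?case
  proof (cases "n \<le> m")
    case True
    then have "replicate m x = replicate n x @ replicate (m - n) x" by (simp flip: replicate_add)
    then have "subseq (blocks (x + 1) ns) (replicate (m - n) x @ blocks (x + 1) ms')"
      using s by (simp add: subseq_append')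
    moreover have "blocks (x + 1) ns = [] \<or> hd (blocks (x + 1) ns) \<noteq> x"
      using hd_blocks[of ns "x + 1"] Cons.prems(2) x by (cases ns) auto
    ultimately have "subseq (blocks (x + 1) ns) (blocks (x + 1) ms')" using drop by blast
    then show ?thesis using Cons.IH[of "x + 1" ms'] Cons.prems True ms by simp
  next
    case False
    \<comment> \<open>A block longer than its run leaves a remainder for later runs, and of those
      there are too few.\<close>
    then have "replicate n x = replicate m x @ replicate (n - m) x" by (simp flip: replicate_add)
    then have "subseq (blocks x ((n - m) # ns)) (blocks (x + 1) ms')"
      using s by (simp add: subseq_append')
    then have "num_runs (blocks x ((n - m) # ns)) \<le> num_runs (blocks (x + 1) ms')"
      by (rule num_runs_subseq)
    moreover have "composition ((n - m) # ns)" "composition ms'" using Cons.prems ms False by auto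
    ultimately have "length ((n - m) # ns) \<le> length ms'" by (metis num_runs_blocks)
    then show ?thesis using Cons.prems(4) ms by simp
  qed
qed simp

lemma B_inj:
  assumes "composition ns" "composition ms" "B ns = B ms"
  shows "ns = ms"
proof -
  have "length ns = length ms" using assms num_runs_B by metis
  then have "list_all2 (\<le>) ns ms" "list_all2 (\<le>) ms ns"
    using assms subseq_blocks_imp_le[of 0] by (simp_all add: B_def)
  then show ?thesis by (auto simp: list_all2_conv_all_nth intro!: nth_equalityI le_antisym)
qed

lemma card_few_runs_cong:
  assumes "composition ns" "composition ms" "length ns = length ms" "sum_list ns = sum_list ms"
    and "ns \<noteq> []"
  shows "card {w \<in> zero_words n. num_runs w \<le> length ns \<and> subseq (B ns) w} =
    card {w \<in> zero_words n. num_runs w \<le> length ms \<and> subseq (B ms) w}"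
proof -
  \<comment> \<open>\<open>D\<close> holds the amounts by which the blocks are enlarged to reach
    length \<open>n\<close>; it depends on \<open>ns\<close> only through the number of parts and
    their sum.\<close>
  define D where "D = {ds. length ds = length ns \<and> sum_list ds + sum_list ns = n}"
  have "card {w \<in> zero_words n. num_runs w \<le> length ks \<and> subseq (B ks) w} = card D"
    if ks: "composition ks" "length ks = length ns" "sum_list ks = sum_list ns" for ks
  proof -
    have add: "composition (map2 (+) ks ds)" "sum_list (map2 (+) ks ds) = sum_list ds + sum_list ks"
      "list_all2 (\<le>) ks (map2 (+) ks ds)"
      if "length ds = length ks" for ds
      using that ks(1) by (induction ds ks rule: list_induct2) (auto simp: composition_def)
    have "{w \<in> zero_words n. num_runs w \<le> length ks \<and> subseq (B ks) w} = (\<lambda>ds. B (map2 (+) ks ds)) ` D"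
    proof (intro equalityI subsetI)
      fix w assume w: "w \<in> {w \<in> zero_words n. num_runs w \<le> length ks \<and> subseq (B ks) w}"
      then obtain ls where ls: "composition ls" "ls \<noteq> []" "w = B ls"
        using word_B[of w] by (auto simp: zero_words_def)
      have "length ls \<le> length ks" using w ls num_runs_B by simp
      then have le: "list_all2 (\<le>) ks ls"
        using subseq_blocks_imp_le[of 0 ks ls] w ls ks(1) by (simp add: B_def)
      define ds where "ds = map2 (-) ls ks"
      have "map2 (+) ks ds = ls" "length ds = length ks"
        using le unfolding ds_def by (auto simp: list_all2_conv_all_nth intro!: nth_equalityI)
      moreover have "sum_list ls = n" using w ls(3) by (auto simp: zero_words_def length_B)
      ultimately show "w \<in> (\<lambda>ds. B (map2 (+) ks ds)) ` D"
        using add(2)[of ds] ks ls(3) by (intro image_eqI[of _ _ ds]) (auto simp: D_def)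
    next
      fix w assume "w \<in> (\<lambda>ds. B (map2 (+) ks ds)) ` D"
      then obtain ds where ds: "w = B (map2 (+) ks ds)" "length ds = length ks"
        "sum_list ds + sum_list ks = n" using ks by (auto simp: D_def)
      have "ks \<noteq> []" using ks(2) assms(5) by auto
      then have ne: "map2 (+) ks ds \<noteq> []" using ds(2) by (cases ks; cases ds) auto
      show "w \<in> {w \<in> zero_words n. num_runs w \<le> length ks \<and> subseq (B ks) w}"
        using add[OF ds(2)] ds ne subseq_blocks_mono[OF add(3)[OF ds(2)], of 0]
        by (auto simp: zero_words_def length_B num_runs_B hd_B B_Nil_iff simp flip: B_def)
    qed
    moreover have "inj_on (\<lambda>ds. B (map2 (+) ks ds)) D"
    proof (rule inj_onI)
      fix ds ds' assume d: "ds \<in> D" "ds' \<in> D" "B (map2 (+) ks ds) = B (map2 (+) ks ds')"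
      then have "map2 (+) ks ds = map2 (+) ks ds'" using add ks B_inj by (simp add: D_def)
      then have nth: "map2 (+) ks ds ! i = map2 (+) ks ds' ! i" for i by simp
      have "ds ! i = ds' ! i" if "i < length ks" for i
      proof -
        have "i < length (zip ks ds)" "i < length (zip ks ds')" using that d ks by (simp_all add: D_def)
        then show ?thesis using nth[of i] by simp
      qed
      then show "ds = ds'" using d ks by (intro nth_equalityI) (auto simp: D_def)
    qed
    ultimately show ?thesis by (simp add: card_image)
  qed
  then show ?thesis using assms by simp
qed

section \<open>Symmetries\<close>

lemma wilf_equivalent_refl: "wilf_equivalent A A"
  by (simp add: wilf_equivalent_def)

lemma wilf_equivalent_trans:
  "wilf_equivalent A A' \<Longrightarrow> wilf_equivalent A' A'' \<Longrightarrow> wilf_equivalent A A''"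
  by (simp add: wilf_equivalent_def)

lemma wilf_equivalent_circ:
  "circ q = circ q' \<Longrightarrow> wilf_equivalent {[1, 4, 3, 2], q} {[1, 4, 3, 2], q'}"
  by (intro wilf_equivalent_containers arg_cong[where f = card] containers_circ)

definition rev_compl :: "nat \<Rightarrow> nat list \<Rightarrow> nat list" where
  "rev_compl N p = rev (map (\<lambda>x. N - x) p)"

lemma rev_compl_rev_compl: "set p \<subseteq> {..N} \<Longrightarrow> rev_compl N (rev_compl N p) = p"
proof -
  assume "set p \<subseteq> {..N}"
  then have "map (\<lambda>x. N - (N - x)) p = p" by (intro map_idI) auto
  then show ?thesis by (simp add: rev_compl_def rev_map comp_def)
qed

lemma rev_compl_perm:
  assumes "p \<in> permutations_of_set {1..n}"
  shows "rev_compl (Suc n) p \<in> permutations_of_set {1..n}"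
proof -
  have p: "set p = {1..n}" "distinct p" using permutations_of_setD[OF assms] by auto
  have "inj_on (\<lambda>x. Suc n - x) {1..n}" by (auto simp: inj_on_def)
  moreover have "(\<lambda>x. Suc n - x) ` {1..n} = {1..n}"
  proof (intro equalityI subsetI)
    fix x assume "x \<in> {1..n}"
    then have "Suc n - x \<in> {1..n}" "x = Suc n - (Suc n - x)" by auto
    then show "x \<in> (\<lambda>x. Suc n - x) ` {1..n}" by (rule rev_image_eqI)
  qed auto
  ultimately show ?thesis using p by (simp add: rev_compl_def permutations_of_set_def distinct_map)
qed

lemma rev_compl_circ: "q' \<in> circ q \<Longrightarrow> rev_compl N q' \<in> circ (rev_compl N q)"
proof -
  assume "q' \<in> circ q"
  then obtain k where q': "q' = drop (k mod length q) q @ take (k mod length q) q"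
    by (auto simp: circ_def rotate_drop_take)
  define x y where "x = take (k mod length q) q" and "y = drop (k mod length q) q"
  have "q = x @ y" "q' = y @ x" by (simp_all add: x_def y_def q')
  then show ?thesis using circ_append[of "rev_compl N x" "rev_compl N y"] by (simp add: rev_compl_def)
qed

lemma circ_contains_rev_compl:
  assumes "circ_contains p q" "set p \<subseteq> {..M}" "set q \<subseteq> {..N}"
  shows "circ_contains (rev_compl M p) (rev_compl N q)"
proof -
  obtain q' t where t: "q' \<in> circ q" "subseq t p" "order_isomorphic t q'"
    using assms(1) circ_contains_linear by blast
  obtain zs where zs: "t = map fst zs" "q' = map snd zs"
    "\<And>x y. x \<in> set zs \<Longrightarrow> y \<in> set zs \<Longrightarrow> fst x < fst y \<longleftrightarrow> snd x < snd y"
    using order_isomorphic_zip[OF t(3)] by blast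
  have "set t \<subseteq> {..M}" using t(2) assms(2) by (auto dest: list_emb_set)
  moreover have "set q' \<subseteq> {..N}" using t(1) assms(3) by (auto simp: circ_def)
  ultimately have le: "fst z \<le> M" "snd z \<le> N" if "z \<in> set zs" for z
    using that unfolding zs(1,2) by auto
  \<comment> \<open>Subtraction on \<open>nat\<close> reverses the order strictly only up to the
    bound, hence the bounds on host and pattern.\<close>
  have flip: "k - a < k - b \<longleftrightarrow> b < a" if "a \<le> k" "b \<le> k" for a b k :: nat
    using that by linarith
  have "order_isomorphic (map (\<lambda>z. M - fst z) (rev zs)) (map (\<lambda>z. N - snd z) (rev zs))"
    unfolding order_isomorphic_map_iff using zs(3) le by (simp add: flip)
  then have "order_isomorphic (rev_compl M t) (rev_compl N q')"
    unfolding rev_compl_def zs(1,2) by (simp add: rev_map comp_def)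
  moreover have "subseq (rev_compl M t) (rev_compl M p)" using t(2) unfolding rev_compl_def by (intro subseq_rev subseq_map)
  ultimately show ?thesis using rev_compl_circ[OF t(1)] circ_contains_linear by blast
qed

text \<open>The reverse complement of 1432 is 3214, one of its rotations, so the symmetry preserves
  the avoidance of 1432. Applied to whole classes it is injective, which gives one
  inequality.\<close>

lemma wilf_equivalent_rev_compl:
  assumes q: "q \<in> permutations_of_set {1..n}"
  shows "wilf_equivalent {[1, 4, 3, 2], q} {[1, 4, 3, 2], rev_compl (Suc n) q}"
proof -
  have bound: "set p \<subseteq> {..Suc k}" if "p \<in> permutations_of_set {1..k}" for p k
    using permutations_of_setD(1)[OF that] by auto
  have "rev_compl 5 [1, 4, 3, 2] \<in> circ [1, 4, 3, 2]" by (simp add: rev_compl_def circ_code)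
  note c1432 = circ_contains_in_circ[OF this]
  have le: "card (Av m {[1, 4, 3, 2], r}) \<le> card (Av m {[1, 4, 3, 2], rev_compl (Suc n) r})"
    if r: "r \<in> permutations_of_set {1..n}" for m r
  proof (rule card_inj_on_le)
    have fin: "finite (Av m Q)" for Q
      by (rule finite_subset[of _ "circ ` permutations_of_set {1..m}"]) (auto simp: Av_def)
    then show "finite (Av m {[1, 4, 3, 2], rev_compl (Suc n) r})" .
    have circ_perm: "\<exists>p\<in>permutations_of_set {1..m}. c = circ p" if "c \<in> Av m {[1, 4, 3, 2], r}" for c
      using that by (auto simp: Av_def)
    have inv: "rev_compl (Suc m) ` rev_compl (Suc m) ` c = c" if "c \<in> Av m {[1, 4, 3, 2], r}" for c
    proof -
      have "rev_compl (Suc m) (rev_compl (Suc m) x) = x" if "x \<in> c" for x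
        using circ_perm[OF \<open>c \<in> _\<close>] that bound circ_permutation rev_compl_rev_compl by metis
      then show ?thesis by (simp add: image_image)
    qed
    show "inj_on ((`) (rev_compl (Suc m))) (Av m {[1, 4, 3, 2], r})"
      by (rule inj_on_inverseI[of _ "(`) (rev_compl (Suc m))"]) (rule inv)
    show "(`) (rev_compl (Suc m)) ` Av m {[1, 4, 3, 2], r} \<subseteq> Av m {[1, 4, 3, 2], rev_compl (Suc n) r}"
    proof
      fix c' assume "c' \<in> (`) (rev_compl (Suc m)) ` Av m {[1, 4, 3, 2], r}"
      then obtain p where p: "c' = rev_compl (Suc m) ` circ p" "p \<in> permutations_of_set {1..m}"
        "circ_avoids p [1, 4, 3, 2]" "circ_avoids p r" by (auto simp: Av_def)
      let ?p = "rev_compl (Suc m) p"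
      have pp: "rev_compl (Suc m) ?p = p" using rev_compl_rev_compl bound p(2) by blast
      have perm: "?p \<in> permutations_of_set {1..m}" using rev_compl_perm p(2) by blast
      have "c' = circ ?p"
      proof (intro equalityI subsetI)
        fix x assume "x \<in> c'"
        then show "x \<in> circ ?p" using p(1) rev_compl_circ by blast
      next
        fix x assume x: "x \<in> circ ?p"
        then have "rev_compl (Suc m) x \<in> circ p" using rev_compl_circ[OF x, of "Suc m"] pp by simp
        moreover have "x = rev_compl (Suc m) (rev_compl (Suc m) x)"
          using rev_compl_rev_compl[OF bound[OF circ_permutation[OF x perm]]] by simp
        ultimately show "x \<in> c'" using p(1) by blast
      qed
      moreover have "circ_avoids ?p [1, 4, 3, 2]"
      proof
        assume "circ_contains ?p [1, 4, 3, 2]"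
        then have "circ_contains (rev_compl (Suc m) ?p) (rev_compl 5 [1, 4, 3, 2])"
          by (rule circ_contains_rev_compl[OF _ bound[OF perm]]) simp
        then show False using pp p(3) c1432 by simp
      qed
      moreover have "circ_avoids ?p (rev_compl (Suc n) r)"
      proof
        assume "circ_contains ?p (rev_compl (Suc n) r)"
        then have "circ_contains (rev_compl (Suc m) ?p) (rev_compl (Suc n) (rev_compl (Suc n) r))"
          by (rule circ_contains_rev_compl[OF _ bound[OF perm] bound[OF rev_compl_perm[OF r]]])
        then show False using pp p(4) rev_compl_rev_compl[OF bound[OF r]] by simp
      qed
      ultimately show "c' \<in> Av m {[1, 4, 3, 2], rev_compl (Suc n) r}" using perm by (auto simp: Av_def)
    qed
  qed
  \<comment> \<open>Reverse complement is an involution on patterns, so the inequality for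
    \<open>q\<close> and for its image gives equality.\<close>
  show ?thesis
    unfolding wilf_equivalent_def
    using le[OF q] le[OF rev_compl_perm[OF q]] rev_compl_rev_compl[OF bound[OF q]] by (metis antisym)
qed

text \<open>Reversing positions turns a 0 before a 1 into a 1 before a 0, and complementing the
  letters turns it back, while the two order reversals cancel on the entries.\<close>

lemma rev_compl_inv_grass: "rev_compl (Suc (length w)) (inv_grass w) = inv_grass (complement (rev w))"
proof -
  define n where "n = length w"
  have "standardizes (rev_compl (Suc n) (inv_grass w)) (complement w)"
    unfolding standardizes_nth
  proof (intro conjI allI impI)
    show "length (rev_compl (Suc n) (inv_grass w)) = length (complement w)" by (simp add: rev_compl_def)
    fix i j assume ij: "i < j" "j < length (complement w)"
    then have ijn: "i < n" "j < n" by (simp_all add: n_def)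
    define i' j' where "i' = n - Suc i" and "j' = n - Suc j"
    have lt: "j' < i'" "i' < length (rev w)" using ij ijn by (auto simp: i'_def j'_def n_def)
    have std: "if rev w ! j' = 0 \<and> rev w ! i' = 1 then inv_grass w ! i' < inv_grass w ! j' else inv_grass w ! j' < inv_grass w ! i'"
      using inv_grass_standardizes[of w] lt unfolding standardizes_nth by blast
    have letters: "complement w ! i = rev w ! i' + 1" "complement w ! j = rev w ! j' + 1"
      using ijn by (simp_all add: complement_def rev_nth i'_def j'_def n_def)
    have vals: "rev_compl (Suc n) (inv_grass w) ! i = Suc n - inv_grass w ! i'" "rev_compl (Suc n) (inv_grass w) ! j = Suc n - inv_grass w ! j'"
      using ijn by (simp_all add: rev_compl_def rev_nth i'_def j'_def n_def)
    have "inv_grass w ! i' \<in> {1..n}" "inv_grass w ! j' \<in> {1..n}"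
      using permutations_of_setD(1)[OF inv_grass_perm[of w]] nth_mem[of _ "inv_grass w"] lt by (auto simp: n_def)
    then show "if complement w ! i = 0 \<and> complement w ! j = 1
      then rev_compl (Suc n) (inv_grass w) ! j < rev_compl (Suc n) (inv_grass w) ! i
      else rev_compl (Suc n) (inv_grass w) ! i < rev_compl (Suc n) (inv_grass w) ! j"
      using std unfolding letters vals
      by (cases "rev w ! i'"; cases "rev w ! j'") auto
  qed
  then show ?thesis
    using standardizes_perm_eq[OF _ rev_compl_perm[OF inv_grass_perm[of w]]] by (simp add: n_def)
qed

section \<open>Permutations of words with at most four runs\<close>

text \<open>Four intervals of values occur in the block order 1324, an involution, so inverting only
  exchanges the lengths of the two middle ones. Blocks may be empty, which also covers words with
  fewer runs.\<close>

lemma inv_grass_four_blocks: "inv_grass (blocks 0 [a, b, c, d]) = grass (blocks 0 [a, c, b, d])"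
proof -
  define n where "n = a + b + c + d"
  \<comment> \<open>The intervals of values with constant letter, from the smallest values up and
    hence from the last block of the word to the first.\<close>
  define S1 S2 S3 S4 where "S1 = [1..<Suc d]" and "S2 = [Suc d..<Suc (d + b)]"
    and "S3 = [Suc (d + b)..<Suc (d + b + c)]" and "S4 = [Suc (d + b + c)..<Suc n]"
  define w where "w = blocks 0 [a, c, b, d]"
  define f where "f v = w ! (n - v)" for v
  have w: "length w = n" by (simp add: w_def n_def)
  have upt_split: "[i..<k] = [i..<j] @ [j..<k]" if "i \<le> j" "j \<le> k" for i j k
    using that upt_add_eq_append[of i j "k - j"] by simp
  have split: "[1..<Suc n] = S1 @ S2 @ S3 @ S4"
    unfolding S1_def S2_def S3_def S4_def n_def
    using upt_split[of 1 "Suc d" "Suc n"] upt_split[of "Suc d" "Suc (d + b)" "Suc n"]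
      upt_split[of "Suc (d + b)" "Suc (d + b + c)" "Suc n"] by (simp add: n_def del: upt_Suc)
  have letters: "\<forall>v\<in>set S1. f v = 1" "\<forall>v\<in>set S2. f v = 0" "\<forall>v\<in>set S3. f v = 1" "\<forall>v\<in>set S4. f v = 0"
    unfolding S1_def S2_def S3_def S4_def f_def w_def n_def
    by (auto simp: nth_append simp del: upt_Suc)
  have filters: "filter (\<lambda>v. f v = x) S = (if x = y then S else [])" if "\<forall>v\<in>set S. f v = y" for x y S
    using that by (auto simp: filter_empty_conv)
  have "grass w = S1 @ S3 @ S2 @ S4"
    unfolding grass_def arrange_def w f_def[symmetric] split filter_append
      filters[OF letters(1)] filters[OF letters(2)] filters[OF letters(3)] filters[OF letters(4)]
    by simp
  moreover have "standardizes (S1 @ S3 @ S2 @ S4)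
      (replicate d 1 @ replicate c 0 @ replicate b 1 @ replicate a 0)"
  proof -
    have seg: "standardizes [i..<j] (replicate (j - i) x)" for i j and x :: bit
      by (auto simp: standardizes_nth)
    have len: "length S1 = d" "length S2 = b" "length S3 = c" "length S4 = a"
      by (simp_all add: S1_def S2_def S3_def S4_def n_def)
    have "standardizes S1 (replicate d 1)" "standardizes S2 (replicate b 1)"
      "standardizes S3 (replicate c 0)" "standardizes S4 (replicate a 0)"
      using seg[of 1 "Suc d" 1] seg[of "Suc d" "Suc (d + b)" 1]
        seg[of "Suc (d + b)" "Suc (d + b + c)" 0] seg[of "Suc (d + b + c)" "Suc n" 0]
      by (simp_all add: S1_def S2_def S3_def S4_def n_def del: upt_Suc)
    moreover have "std_rel z z'"
      if "z \<in> set (zip xs (replicate k x))" "z' \<in> set (zip ys (replicate l y))"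
        "\<forall>i\<in>set xs. \<forall>j\<in>set ys. if x = 0 \<and> y = 1 then j < i else i < j" for z z' xs ys k l x y
    proof -
      have "fst z \<in> set xs" "snd z = x" "fst z' \<in> set ys" "snd z' = y"
        using that(1,2) by (metis in_set_replicate prod.collapse set_zip_leftD set_zip_rightD)+
      then show ?thesis using that(3) by (simp add: std_rel_def)
    qed
    note cross = this
    have mem: "i \<in> set S1 \<longleftrightarrow> 1 \<le> i \<and> i \<le> d" "i \<in> set S2 \<longleftrightarrow> d < i \<and> i \<le> d + b"
      "i \<in> set S3 \<longleftrightarrow> d + b < i \<and> i \<le> d + b + c" "i \<in> set S4 \<longleftrightarrow> d + b + c < i \<and> i \<le> n" for i
      by (auto simp: S1_def S2_def S3_def S4_def simp del: upt_Suc)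
    ultimately show ?thesis
      by (auto simp: standardizes_append len zip_append mem intro!: cross)
  qed
  ultimately have "standardizes (grass w) (rev (blocks 0 [a, b, c, d]))" by (simp add: numeral_eq_Suc)
  from standardizes_perm_eq[OF this grass_perm[of w]] show ?thesis unfolding w_def rev_rev_ident by (rule sym)
qed

text \<open>Missing runs are padded with blocks of length 0.\<close>

lemma few_runs_blocks:
  assumes "w \<noteq> []" "hd w = 0" "num_runs w \<le> 4"
  shows "\<exists>a b c d. a \<ge> 1 \<and> w = blocks 0 [a, b, c, d] \<and> (num_runs w \<le> 3 \<longrightarrow> d = 0)"
proof -
  obtain ls where ls: "composition ls" "ls \<noteq> []" "w = B ls" using word_B assms(1,2) by blast
  then have len: "length ls \<le> 4" "num_runs w = length ls" using assms(3) num_runs_B by auto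
  obtain a r1 where 1: "ls = a # r1" using ls(2) by (cases ls) auto
  show ?thesis
  proof (cases r1)
    case Nil
    then show ?thesis using 1 ls by (intro exI[of _ a] exI[of _ 0] exI[of _ 0] exI[of _ 0]) (simp add: B_def)
  next
    case 2: (Cons b r2)
    show ?thesis
    proof (cases r2)
      case Nil
      then show ?thesis using 1 2 ls by (intro exI[of _ a] exI[of _ b] exI[of _ 0] exI[of _ 0]) (simp add: B_def)
    next
      case 3: (Cons c r3)
      show ?thesis
      proof (cases r3)
        case Nil
        then show ?thesis using 1 2 3 ls by (intro exI[of _ a] exI[of _ b] exI[of _ c] exI[of _ 0]) (simp add: B_def)
      next
        case (Cons d r4)
        then show ?thesis using 1 2 3 ls len by (intro exI[of _ a] exI[of _ b] exI[of _ c] exI[of _ d]) (simp add: B_def)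
      qed
    qed
  qed
qed

text \<open>With the middle parts exchanged, the pattern is also an \<open>inv_grass\<close>, so
  members of both families can contain it. Words with at most four runs give permutations that are
  already counted on the \<open>grass\<close> side; the difference counts the words with at least
  five runs on the other side.\<close>

lemma card_containers_grass_four_runs:
  assumes comp: "composition [a, b, c, d]"
  shows "card (containers n (grass (B [a, b, c, d]))) = card {w \<in> zero_words n. has_word (B [a, b, c, d]) w} +
    (card {w \<in> zero_words n. subseq (B [a, c, b, d]) w} -
     card {w \<in> zero_words n. num_runs w \<le> 4 \<and> subseq (B [a, c, b, d]) w})"
proof -
  define v v' where "v = B [a, b, c, d]" and "v' = B [a, c, b, d]"
  have v: "hd v = 0" "num_runs v \<ge> 3" and v': "hd v' = 0" "num_runs v' \<ge> 3"
    using comp hd_B[of "[a, b, c, d]"] hd_B[of "[a, c, b, d]"]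
      num_runs_B[of "[a, b, c, d]"] num_runs_B[of "[a, c, b, d]"] by (simp_all add: v_def v'_def)
  have gv: "grass v = inv_grass v'" using inv_grass_four_blocks[of a c b d] by (simp add: v_def v'_def B_def)
  let ?A = "{w \<in> zero_words n. has_word v w}" and ?B = "{w \<in> zero_words n. num_runs w \<ge> 5 \<and> subseq v' w}"
  have cg: "circ_contains (grass w) (grass v) \<longleftrightarrow> has_word v w" for w
    using grass_contains_grass[OF v] by (simp add: has_word_def)
  have ci: "circ_contains (inv_grass w) (grass v) \<longleftrightarrow> subseq v' w" for w
  proof -
    \<comment> \<open>\<open>v'\<close> ends in 1, so it has no trailing 0 to trade for a leading
      1.\<close>
    have "j = 0" if "v' = u @ replicate j 0" for j u
    proof (rule ccontr)
      assume "j \<noteq> 0"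
      then have "last v' = 0" using that by simp
      moreover have "last v' = 1" using comp by (simp add: v'_def B_def)
      ultimately show False by simp
    qed
    then have "(\<exists>j u. subseq (replicate j 1 @ u) w \<and> v' = u @ replicate j 0) \<longleftrightarrow> subseq v' w"
      by (metis append.right_neutral append_Nil replicate_0)
    then show ?thesis using inv_grass_contains_inv_grass[OF v'] gv by simp
  qed
  have few: "\<exists>w'\<in>zero_words n. inv_grass w = grass w'" if "w \<in> zero_words n" "\<not> num_runs w \<ge> 5" for w
  proof -
    have "w \<noteq> []" "hd w = 0" "num_runs w \<le> 4" using that by (simp_all add: zero_words_def)
    then obtain a b c d where w: "a \<ge> 1" "w = blocks 0 [a, b, c, d]"
      using few_runs_blocks by blast
    then have "blocks 0 [a, c, b, d] \<in> zero_words n" using that(1) by (auto simp: zero_words_def hd_append)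
    then show ?thesis using inv_grass_four_blocks w(2) by blast
  qed
  have "containers n (grass v) = grass ` ?A \<union> inv_grass ` ?B"
  proof (intro equalityI subsetI)
    fix p assume "p \<in> containers n (grass v)"
    then have p: "p \<in> grass ` zero_words n \<union> inv_grass ` zero_words n" "circ_contains p (grass v)" by (auto simp: containers_def avoiders_eq)
    show "p \<in> grass ` ?A \<union> inv_grass ` ?B"
    proof (cases "p \<in> grass ` zero_words n")
      case True
      then show ?thesis using p(2) cg by auto
    next
      case False
      then obtain w where w: "w \<in> zero_words n" "p = inv_grass w" using p(1) by blast
      then have "num_runs w \<ge> 5" using few False by blast
      then show ?thesis using w p(2) ci by auto
    qed
  next
    fix p assume "p \<in> grass ` ?A \<union> inv_grass ` ?B"
    then show "p \<in> containers n (grass v)" using cg ci by (auto simp: containers_def avoiders_eq)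
  qed
  moreover have "grass ` ?A \<inter> inv_grass ` ?B = {}"
  proof -
    \<comment> \<open>A common permutation would be a \<open>grass u\<close> containing
      \<open>inv_grass w\<close> for a word \<open>w\<close> with at least five runs.\<close>
    have False if "w \<in> ?B" "grass u = inv_grass w" for u w
      using that grass_not_contains_inv_grass[of w u] circ_contains_self[OF self_in_circ, of "inv_grass w"]
      by (auto simp: zero_words_def)
    then show ?thesis by (metis (no_types, lifting) disjoint_iff imageE)
  qed
  moreover have "inj_on grass ?A"
  proof (rule inj_on_subset[OF inj_on_grass], rule subsetI)
    fix w assume "w \<in> ?A"
    then have "w \<in> zero_words n" "num_runs v \<le> num_runs w"
      using num_runs_subseq[of v w] num_runs_subseq[of "complement v" w] by (auto simp: has_word_def)
    then show "w \<in> {w \<in> zero_words n. num_runs w \<ge> 3}" using v by simp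
  qed
  moreover have "inj_on inv_grass ?B"
    by (rule inj_on_subset[OF inj_on_inv_grass]) auto
  ultimately have "card (containers n (grass v)) = card ?A + card ?B"
    by (simp add: card_Un_disjoint card_image)
  moreover have "?B = {w \<in> zero_words n. subseq v' w} - {w \<in> zero_words n. num_runs w \<le> 4 \<and> subseq v' w}" by auto
  then have "card ?B = card {w \<in> zero_words n. subseq v' w} - card {w \<in> zero_words n. num_runs w \<le> 4 \<and> subseq v' w}"
    by (simp only:) (rule card_Diff_subset, auto)
  ultimately show ?thesis by (simp add: v_def v'_def)
qed

text \<open>From five runs on, the count decides. With four runs the other family contributes
  numbers fixed by the sum and the number of parts, which is where their equality enters.\<close>

lemma wilf_equivalent_grass:
  assumes ns: "composition ns" and ms: "composition ms"
    and len: "length ns = length ms" "length ns \<ge> 4" and sum: "sum_list ns = sum_list ms"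
    and count: "\<And>n. count_words (B ns) n = count_words (B ms) n"
  shows "wilf_equivalent {[1, 4, 3, 2], grass (B ns)} {[1, 4, 3, 2], grass (B ms)}"
proof (rule wilf_equivalent_containers)
  fix n :: nat assume "n \<ge> 1"
  have same: "card {w \<in> zero_words n. has_word (B ns) w} = card {w \<in> zero_words n. has_word (B ms) w}"
    using card_zero_words_has_word_cong count by blast
  show "card (containers n (grass (B ns))) = card (containers n (grass (B ms)))"
  proof (cases "length ns = 4")
    case True
    then obtain a b c d where n4: "ns = [a, b, c, d]"
      by (auto simp: numeral_eq_Suc length_Suc_conv)
    obtain a' b' c' d' where m4: "ms = [a', b', c', d']"
      using True len by (auto simp: numeral_eq_Suc length_Suc_conv)
    have comp: "composition [a, c, b, d]" "composition [a', c', b', d']"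
      using ns ms n4 m4 by auto
    have sum': "sum_list [a, c, b, d] = sum_list [a', c', b', d']" using sum n4 m4 by simp
    have "card {w \<in> zero_words n. subseq (B [a, c, b, d]) w} = card {w \<in> zero_words n. subseq (B [a', c', b', d']) w}"
    proof (rule card_zero_words_subseq_cong)
      show "B [a, c, b, d] \<noteq> []" "B [a', c', b', d'] \<noteq> []"
        using B_Nil_iff[OF comp(1)] B_Nil_iff[OF comp(2)] by simp_all
      show "hd (B [a, c, b, d]) = 0" "hd (B [a', c', b', d']) = 0"
        using hd_B[OF comp(1)] hd_B[OF comp(2)] by simp_all
    qed (simp only: length_B sum')
    moreover have "card {w \<in> zero_words n. num_runs w \<le> 4 \<and> subseq (B [a, c, b, d]) w} =
        card {w \<in> zero_words n. num_runs w \<le> 4 \<and> subseq (B [a', c', b', d']) w}"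
      using card_few_runs_cong[OF comp _ sum', of n] by (simp add: numeral_eq_Suc)
    ultimately show ?thesis
      using same card_containers_grass_four_runs[of a b c d n] card_containers_grass_four_runs[of a' b' c' d' n] ns ms
      unfolding n4 m4 by simp
  next
    case False
    then have 5: "length ns \<ge> 5" "length ms \<ge> 5" using len by simp_all
    have "card (containers n (grass (B ks))) = card {w \<in> zero_words n. has_word (B ks) w}"
      if "composition ks" "length ks \<ge> 5" for ks
    proof -
      have "ks \<noteq> []" using that(2) by auto
      then show ?thesis
        using card_containers_grass[of "B ks" n] that by (simp add: hd_B num_runs_B has_word_def)
    qed
    then show ?thesis using same ns ms 5 by simp
  qed
qed

section \<open>Normal forms\<close>

lemma strip_ones:
  "\<exists>s ms r. ls = replicate s 1 @ ms @ replicate r (1::nat) \<and>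
     (ms = [] \<or> hd ms \<noteq> 1 \<and> last ms \<noteq> 1)"
proof (induction ls)
  case Nil
  then show ?case by (intro exI[of _ 0] exI[of _ "[]"]) simp
next
  case (Cons x ls)
  then obtain s ms r where IH: "ls = replicate s 1 @ ms @ replicate r (1::nat)"
    "ms = [] \<or> hd ms \<noteq> 1 \<and> last ms \<noteq> 1" by blast
  consider "x = 1" | "x \<noteq> 1" "ms = []" | "x \<noteq> 1" "ms \<noteq> []" by blast
  then show ?case
  proof cases
    case 1
    then show ?thesis using IH by (intro exI[of _ "Suc s"] exI[of _ ms] exI[of _ r]) simp
  next
    case 2
    then show ?thesis using IH
      by (intro exI[of _ 0] exI[of _ "[x]"] exI[of _ "s + r"]) (simp add: replicate_add)
  next
    case 3
    then show ?thesis using IH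
      by (intro exI[of _ 0] exI[of _ "x # replicate s 1 @ ms"] exI[of _ r]) simp
  qed
qed

text \<open>The outer runs are exchanged by reverse complement, whose effect is known for
  \<open>inv_grass\<close>: passing from \<open>grass\<close> to \<open>inv_grass\<close> and back
  swaps the last two runs, and a rotation in between restores the first letter 0.\<close>

lemma grass_three_runs_form:
  assumes "v \<noteq> []" "hd v = 0" "num_runs v \<le> 3"
  shows "\<exists>a b c. a \<ge> 1 \<and> a \<ge> c \<and> wilf_equivalent {[1, 4, 3, 2], grass v}
    {[1, 4, 3, 2], grass (replicate a 0 @ replicate b 1 @ replicate c 0)}"
proof -
  obtain a b c d where v: "a \<ge> 1" "v = blocks 0 [a, b, c, d]" "d = 0"
  proof -
    have "num_runs v \<le> 4" using assms(3) by simp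
    then show ?thesis using that few_runs_blocks[OF assms(1,2)] assms(3) by blast
  qed
  show ?thesis
  proof (cases "c \<le> a")
    case True
    then show ?thesis
      using v by (intro exI[of _ a] exI[of _ b] exI[of _ c]) (simp add: wilf_equivalent_refl)
  next
    case False
    define w where "w = blocks 0 [a, c, b, 0]"
    have gv: "grass v = inv_grass w" using inv_grass_four_blocks[of a c b 0] v by (simp add: w_def)
    have "complement (rev w) = replicate b 1 @ (replicate c 0 @ replicate a 1)" by (simp add: w_def)
    then have "rev_compl (Suc (length w)) (grass v) = inv_grass (replicate b 1 @ (replicate c 0 @ replicate a 1))"
      using rev_compl_inv_grass[of w] gv by simp
    then have "wilf_equivalent {[1, 4, 3, 2], grass v}
        {[1, 4, 3, 2], inv_grass (replicate b 1 @ (replicate c 0 @ replicate a 1))}"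
      using wilf_equivalent_rev_compl[OF inv_grass_perm[of w]] gv by simp
    moreover have "wilf_equivalent {[1, 4, 3, 2], inv_grass (replicate b 1 @ (replicate c 0 @ replicate a 1))}
        {[1, 4, 3, 2], inv_grass ((replicate c 0 @ replicate a 1) @ replicate b 0)}"
      by (rule wilf_equivalent_circ[OF circ_in_circ[OF inv_grass_rotate, symmetric]])
    moreover have "inv_grass ((replicate c 0 @ replicate a 1) @ replicate b 0) =
        grass (replicate c 0 @ replicate b 1 @ replicate a 0)"
      using inv_grass_four_blocks[of c a b 0] by simp
    ultimately have "wilf_equivalent {[1, 4, 3, 2], grass v}
        {[1, 4, 3, 2], grass (replicate c 0 @ replicate b 1 @ replicate a 0)}"
      using wilf_equivalent_trans by simp
    then show ?thesis
      using False v(1) by (intro exI[of _ c] exI[of _ b] exI[of _ a]) simp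
  qed
qed

lemma grass_form:
  assumes "v \<noteq> []" "hd v = 0" "num_runs v \<ge> 4"
  shows "(\<exists>l\<ge>4. wilf_equivalent {[1, 4, 3, 2], grass v} {[1, 4, 3, 2], grass (B (replicate l 1))}) \<or>
    (\<exists>ns r. ns \<noteq> [] \<and> composition ns \<and> length ns + r \<ge> 4 \<and> hd ns \<noteq> 1 \<and> last ns \<noteq> 1 \<and> rev ns \<le> ns \<and>
      wilf_equivalent {[1, 4, 3, 2], grass v} {[1, 4, 3, 2], grass (B (ns @ replicate r 1))})"
proof -
  obtain ls where ls: "composition ls" "ls \<noteq> []" "v = B ls" using word_B assms(1,2) by blast
  have len: "length ls \<ge> 4" using assms(3) ls num_runs_B by simp
  obtain s ms r where dec: "ls = replicate s 1 @ ms @ replicate r (1::nat)"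
    "ms = [] \<or> hd ms \<noteq> 1 \<and> last ms \<noteq> 1" using strip_ones by blast
  show ?thesis
  proof (cases "ms = []")
    case True
    then have "v = B (replicate (s + r) 1)" "s + r \<ge> 4"
      using ls dec len by (simp_all add: replicate_add)
    then show ?thesis using wilf_equivalent_refl by metis
  next
    case False
    then have ms: "composition ms" "hd ms \<noteq> 1" "last ms \<noteq> 1" using ls(1) dec by auto
    have wilf: "wilf_equivalent {[1, 4, 3, 2], grass v} {[1, 4, 3, 2], grass (B (ns @ replicate (s + r) 1))}"
      if "ns = ms \<or> ns = rev ms" for ns
      unfolding ls(3)
    proof (rule wilf_equivalent_grass)
      show "count_words (B ls) n = count_words (B (ns @ replicate (s + r) 1)) n" for n
        using that count_words_B_move_ones[OF ms(1) False, of s r n]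
          count_words_B_rev_ones[OF ms(1) False, of "s + r" n] dec(1) by auto
    qed (use that ls ms len dec(1) in \<open>auto simp: replicate_add\<close>)
    have len': "length ms + (s + r) \<ge> 4" using len dec(1) by simp
    show ?thesis
    proof (cases "rev ms \<le> ms")
      case True
      then show ?thesis using False ms len' wilf[of ms] by blast
    next
      case f: False
      \<comment> \<open>The lexicographic order is linear, so either the core or its reversal
        satisfies the condition.\<close>
      then have "rev (rev ms) \<le> rev ms" by simp
      moreover have "rev ms \<noteq> []" "composition (rev ms)" "length (rev ms) + (s + r) \<ge> 4"
        "hd (rev ms) \<noteq> 1" "last (rev ms) \<noteq> 1"
        using False ms len' by (simp_all add: hd_rev last_rev)
      ultimately show ?thesis using wilf[of "rev ms"] by blast
    qed
  qed
qed

lemma wilf_equivalent_inv_grass_alternating: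
  assumes v: "hd v = 0" "num_runs v \<ge> 5" and l: "l \<ge> 5"
    and card: "\<And>n. card {w \<in> zero_words n. \<exists>j u. subseq (replicate j 1 @ u) w \<and> v = u @ replicate j 0} =
      card {w \<in> zero_words n. has_word (B (replicate l 1)) w}"
  shows "wilf_equivalent {[1, 4, 3, 2], inv_grass v} {[1, 4, 3, 2], grass (B (replicate l 1))}"
proof (rule wilf_equivalent_containers)
  fix n :: nat
  have "card (containers n (grass (B (replicate l 1)))) = card {w \<in> zero_words n. has_word (B (replicate l 1)) w}"
    using card_containers_grass[of "B (replicate l 1)" n] l hd_B[of "replicate l 1"] num_runs_B[of "replicate l 1"]
    by (simp add: has_word_def)
  then show "card (containers n (inv_grass v)) = card (containers n (grass (B (replicate l 1))))"
    using card_containers_inv_grass[OF v] card by simp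
qed

text \<open>An even number of runs means that the word ends in 1, so the word itself has to be
  embedded. Only its length counts then, and for the alternating word of that length embedding the
  complement adds no word starting with 0.\<close>

lemma inv_grass_even_runs:
  assumes comp: "composition ns" and even: "even (length ns)" and len: "length ns \<ge> 5"
  shows "wilf_equivalent {[1, 4, 3, 2], inv_grass (B ns)} {[1, 4, 3, 2], grass (B (replicate (sum_list ns) 1))}"
proof (rule wilf_equivalent_inv_grass_alternating)
  have ne: "ns \<noteq> []" using len by auto
  have le: "length ns \<le> sum_list ns" using comp by (induction ns) auto
  then show l: "sum_list ns \<ge> 5" using len by simp
  show hd: "hd (B ns) = 0" using hd_B comp ne by blast
  show "num_runs (B ns) \<ge> 5" using num_runs_B comp len by simp
  fix n
  obtain ks k where ks: "ns = ks @ [k]" using ne by (metis append_butlast_last_id)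
  then have "last (B ns) = 1" using even comp by (simp add: B_def blocks_append)
  have "j = 0" if "B ns = u @ replicate j 0" for u j
  proof (rule ccontr)
    assume "j \<noteq> 0"
    then have "last (B ns) = 0" using that by simp
    then show False using \<open>last (B ns) = 1\<close> by simp
  qed
  then have "(\<exists>j u. subseq (replicate j 1 @ u) w \<and> B ns = u @ replicate j 0) \<longleftrightarrow> subseq (B ns) w" for w
    by (metis append.right_neutral append_Nil replicate_0)
  then have "card {w \<in> zero_words n. \<exists>j u. subseq (replicate j 1 @ u) w \<and> B ns = u @ replicate j 0} =
      card {w \<in> zero_words n. subseq (B ns) w}" by simp
  also have "\<dots> = card {w \<in> zero_words n. subseq (B (replicate (sum_list ns) 1)) w}"
  proof (rule card_zero_words_subseq_cong)
    have "composition (replicate m 1)" "replicate m 1 \<noteq> []" if "m \<ge> 5" for m :: nat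
      using that by auto
    note r = this[OF l]
    show "B (replicate (sum_list ns) 1) \<noteq> []" "hd (B (replicate (sum_list ns) 1)) = 0"
      using hd_B[OF r] B_Nil_iff[OF r(1)] r(2) by simp_all
    show "B ns \<noteq> []" using B_Nil_iff comp ne by simp
  qed (simp_all add: hd length_B sum_list_replicate)
  also have "\<dots> = card {w \<in> zero_words n. has_word (B (replicate (sum_list ns) 1)) w}"
  proof -
    have "{w \<in> zero_words n. subseq (B (replicate (sum_list ns) 1)) w} = {w \<in> zero_words n. has_word (B (replicate (sum_list ns) 1)) w}"
      using zero_words_subseq_alternating by (auto simp: has_word_def)
    then show ?thesis by simp
  qed
  finally show "card {w \<in> zero_words n. \<exists>j u. subseq (replicate j 1 @ u) w \<and> B ns = u @ replicate j 0} =
      card {w \<in> zero_words n. has_word (B (replicate (sum_list ns) 1)) w}" .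
qed

text \<open>The word ends in a single 0, so \<open>j\<close> is 0 or 1. Trading that 0 for a leading
  1 gives the complement, which makes the two containment criteria coincide.\<close>

lemma inv_grass_odd_alternating:
  assumes odd: "odd l" and l: "l \<ge> 5"
  shows "wilf_equivalent {[1, 4, 3, 2], inv_grass (B (replicate l 1))} {[1, 4, 3, 2], grass (B (replicate l 1))}"
proof (rule wilf_equivalent_inv_grass_alternating[OF _ _ l])
  define v x where "v = B (replicate l 1)" and "x = B (replicate (l - 1) 1)"
  show "hd (B (replicate l 1)) = 0" using hd_B[of "replicate l 1"] l by simp
  show "num_runs (B (replicate l 1)) \<ge> 5" using num_runs_B[of "replicate l 1"] l by simp
  fix n
  have l1: "replicate l (1::nat) = replicate (l - 1) 1 @ [1]" "replicate l (1::nat) = 1 # replicate (l - 1) 1"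
    using l by (cases l; simp add: replicate_append_same)+
  have v: "v = x @ [0]" unfolding v_def x_def l1(1) B_def blocks_append using odd by simp
  have cv: "complement v = 1 # x" unfolding v_def x_def l1(2) by (simp add: B_def)
  have lastx: "last x = 1"
  proof -
    define k where "k = l - 2"
    have k: "l - 1 = Suc k" "odd k" using odd l by (simp_all add: k_def)
    show ?thesis
      unfolding x_def k(1) replicate_Suc replicate_append_same[symmetric] B_def blocks_append
      using k(2) by simp
  qed
  have "(\<exists>j u. subseq (replicate j 1 @ u) w \<and> v = u @ replicate j 0) \<longleftrightarrow> has_word v w" for w
  proof
    assume "\<exists>j u. subseq (replicate j 1 @ u) w \<and> v = u @ replicate j 0"
    then obtain j u where ju: "subseq (replicate j 1 @ u) w" "v = u @ replicate j 0" by blast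
    consider "j = 0" | "j = 1" | i where "j = Suc (Suc i)"
      by (metis One_nat_def not0_implies_Suc)
    then show "has_word v w"
    proof cases
      case 1
      then show ?thesis using ju by (simp add: has_word_def)
    next
      case 2
      then have "u = x" using ju(2) v by simp
      then show ?thesis using ju(1) cv 2 by (simp add: has_word_def)
    next
      case 3
      \<comment> \<open>Two traded 0s would require \<open>v\<close> to end in 00.\<close>
      then have "x = u @ replicate (Suc i) 0"
        using ju(2) v by (simp add: replicate_append_same[symmetric] del: replicate.simps(2))
          (simp add: replicate_append_same[symmetric])
      then have "last x = 0" by simp
      then show ?thesis using lastx by simp
    qed
  next
    assume "has_word v w"
    then consider "subseq (replicate 0 1 @ v) w" "v = v @ replicate 0 0"
      | "subseq (replicate 1 1 @ x) w" "v = x @ replicate 1 0"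
      using cv v by (auto simp: has_word_def)
    then show "\<exists>j u. subseq (replicate j 1 @ u) w \<and> v = u @ replicate j 0" by cases blast+
  qed
  then show "card {w \<in> zero_words n. \<exists>j u. subseq (replicate j 1 @ u) w \<and> B (replicate l 1) = u @ replicate j 0} =
      card {w \<in> zero_words n. has_word (B (replicate l 1)) w}"
    unfolding v_def by simp
qed

text \<open>Reverse complement turns the final \<open>k\<close> letters 0 into leading 1s, and a
  rotation turns these back into trailing 0s; the net effect is to reverse \<open>ns\<close>
  alone.\<close>

lemma inv_grass_rev_form:
  assumes "even (length ns)"
  shows "wilf_equivalent {[1, 4, 3, 2], inv_grass (B (ns @ [k]))} {[1, 4, 3, 2], inv_grass (B (rev ns @ [k]))}"
proof -
  have rev_even: "rev (blocks x ns) = blocks (if even (length ns) then x + 1 else x) (rev ns)"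
    for x and ns :: "nat list"
    by (induction ns arbitrary: x) (simp_all add: blocks_append)
  have "complement (rev (B (ns @ [k]))) = replicate k 1 @ blocks 0 (rev ns)"
    using assms by (simp add: B_def blocks_append rev_even flip: complement_simps(6))
  then have "wilf_equivalent {[1, 4, 3, 2], inv_grass (B (ns @ [k]))}
      {[1, 4, 3, 2], inv_grass (replicate k 1 @ blocks 0 (rev ns))}"
    using wilf_equivalent_rev_compl[OF inv_grass_perm[of "B (ns @ [k])"]] rev_compl_inv_grass[of "B (ns @ [k])"] by simp
  moreover have "wilf_equivalent {[1, 4, 3, 2], inv_grass (replicate k 1 @ blocks 0 (rev ns))}
      {[1, 4, 3, 2], inv_grass (blocks 0 (rev ns) @ replicate k 0)}"
    by (rule wilf_equivalent_circ[OF circ_in_circ[OF inv_grass_rotate, symmetric]])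
  moreover have "blocks 0 (rev ns) @ replicate k 0 = B (rev ns @ [k])"
    using assms by (simp add: B_def blocks_append)
  ultimately show ?thesis using wilf_equivalent_trans by simp
qed

lemma inv_grass_form:
  assumes "v \<noteq> []" "hd v = 0" "num_runs v \<ge> 5"
  shows "(\<exists>l\<ge>5. wilf_equivalent {[1, 4, 3, 2], inv_grass v} {[1, 4, 3, 2], grass (B (replicate l 1))}) \<or>
    (\<exists>ns k. even (length ns) \<and> composition ns \<and> k \<ge> 1 \<and> length ns \<ge> 4 \<and>
      \<not> distinct_adj (B (ns @ [k])) \<and> rev ns \<le> ns \<and>
      wilf_equivalent {[1, 4, 3, 2], inv_grass v} {[1, 4, 3, 2], inv_grass (B (ns @ [k]))})"
proof -
  obtain ls where ls: "composition ls" "ls \<noteq> []" "v = B ls" using word_B assms(1,2) by blast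
  have len: "length ls \<ge> 5" using assms(3) ls num_runs_B by simp
  show ?thesis
  proof (cases "even (length ls)")
    case True
    have "length ls \<le> sum_list ls" using ls(1) by (induction ls) auto
    then have "sum_list ls \<ge> 5" using len by simp
    then show ?thesis using inv_grass_even_runs[OF ls(1) True len] ls(3) by blast
  next
    case odd: False
    obtain ns k where nk: "ls = ns @ [k]" using ls(2) by (metis append_butlast_last_id)
    show ?thesis
    proof (cases "distinct_adj v")
      case True
      then have "ls = replicate (length ls) 1" using distinct_adj_B ls by simp
      then show ?thesis using inv_grass_odd_alternating[OF odd len] ls(3) len by metis
    next
      case False
      have ns: "even (length ns)" "composition ns" "k \<ge> 1" "length ns \<ge> 4"
        using odd len ls(1) nk by auto
      \<comment> \<open>Phrased through \<open>set ms\<close>, alternation is visibly unaffected by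
        reversing \<open>ms\<close>.\<close>
      have alt: "distinct_adj (B (ms @ [k])) \<longleftrightarrow> set ms \<subseteq> {1} \<and> k = 1" if "composition ms" for ms
      proof -
        have "xs = replicate (length xs) 1 \<longleftrightarrow> set xs \<subseteq> {1}" for xs :: "nat list"
          by (induction xs) auto
        from this[of "ms @ [k]"] show ?thesis using distinct_adj_B[of "ms @ [k]"] that ns(3) by auto
      qed
      have na: "\<not> (set ns \<subseteq> {1} \<and> k = 1)" using False alt[OF ns(2)] ls(3) nk by simp
      show ?thesis
      proof (cases "rev ns \<le> ns")
        case True
        then show ?thesis using ns na alt[OF ns(2)] ls(3) nk wilf_equivalent_refl by blast
      next
        case False
        then have "rev (rev ns) \<le> rev ns" by simp
        moreover have "\<not> distinct_adj (B (rev ns @ [k]))" using na alt[of "rev ns"] ns(2) by simp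
        moreover have "even (length (rev ns))" "composition (rev ns)" "length (rev ns) \<ge> 4"
          using ns by simp_all
        ultimately show ?thesis using ns(3) inv_grass_rev_form[OF ns(1), of k] ls(3) nk by blast
      qed
    qed
  qed
qed

theorem theorem5p22:
  fixes n :: nat and \<sigma> :: "nat list"
  assumes "n \<ge> 1"
    and "\<sigma> \<in> permutations_of_set {1..n}"
    and "circ_avoids \<sigma> [1, 4, 3, 2]"
  shows "\<exists>m \<tau>. m \<ge> 1 \<and> \<tau> \<in> permutations_of_set {1..m} \<and>
     wilf_equivalent {[1, 4, 3, 2], \<sigma>} {[1, 4, 3, 2], \<tau>} \<and>
     ((\<exists>a b c w. w = replicate a 0 @ replicate b 1 @ replicate c 0 \<and>
         a \<ge> 1 \<and> a \<ge> c \<and> circ \<tau> = circ (G w))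
    \<or> (\<exists>w. distinct_adj w \<and> hd w = 0 \<and> num_runs w \<ge> 4 \<and> circ \<tau> = circ (G w))
    \<or> (\<exists>ns r w. ns \<noteq> [] \<and> composition ns \<and> w = B (ns @ replicate r 1) \<and>
         num_runs w \<ge> 4 \<and> hd ns \<noteq> 1 \<and> last ns \<noteq> 1 \<and> rev ns \<le> ns \<and>
         circ \<tau> = circ (G w))
    \<or> (\<exists>ns k w. even (length ns) \<and> composition ns \<and> k \<ge> 1 \<and> w = B (ns @ [k]) \<and>
         \<not> distinct_adj w \<and> num_runs w \<ge> 5 \<and> rev ns \<le> ns \<and>
         circ \<tau> = circ (IG w)))"
proof -
  define normal_form where "normal_form \<tau> \<longleftrightarrow>
     ((\<exists>a b c w. w = replicate a 0 @ replicate b 1 @ replicate c 0 \<and>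
         a \<ge> 1 \<and> a \<ge> c \<and> circ \<tau> = circ (G w))
    \<or> (\<exists>w. distinct_adj w \<and> hd w = 0 \<and> num_runs w \<ge> 4 \<and> circ \<tau> = circ (G w))
    \<or> (\<exists>ns r w. ns \<noteq> [] \<and> composition ns \<and> w = B (ns @ replicate r 1) \<and>
         num_runs w \<ge> 4 \<and> hd ns \<noteq> 1 \<and> last ns \<noteq> 1 \<and> rev ns \<le> ns \<and>
         circ \<tau> = circ (G w))
    \<or> (\<exists>ns k w. even (length ns) \<and> composition ns \<and> k \<ge> 1 \<and> w = B (ns @ [k]) \<and>
         \<not> distinct_adj w \<and> num_runs w \<ge> 5 \<and> rev ns \<le> ns \<and>
         circ \<tau> = circ (IG w)))" for \<tau>
  have form1: "normal_form \<tau>" if "a \<ge> 1" "a \<ge> c" "circ \<tau> = circ (G (replicate a 0 @ replicate b 1 @ replicate c 0))"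
    for a b c \<tau>
    unfolding normal_form_def using that
    by - (rule disjI1, rule exI[of _ a], rule exI[of _ b], rule exI[of _ c], simp)
  have form2: "normal_form \<tau>" if "distinct_adj w" "hd w = 0" "num_runs w \<ge> 4" "circ \<tau> = circ (G w)" for w \<tau>
    unfolding normal_form_def using that by (intro disjI2[OF disjI1] exI[of _ w] conjI)
  have form3: "normal_form \<tau>" if "ns \<noteq> []" "composition ns" "num_runs (B (ns @ replicate r 1)) \<ge> 4"
    "hd ns \<noteq> 1" "last ns \<noteq> 1" "rev ns \<le> ns" "circ \<tau> = circ (G (B (ns @ replicate r 1)))" for ns r \<tau>
    unfolding normal_form_def using that
    by - (rule disjI2[OF disjI2[OF disjI1]], rule exI[of _ ns], rule exI[of _ r], simp)
  have form4: "normal_form \<tau>" if "even (length ns)" "composition ns" "k \<ge> 1" "\<not> distinct_adj (B (ns @ [k]))"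
    "num_runs (B (ns @ [k])) \<ge> 5" "rev ns \<le> ns" "circ \<tau> = circ (IG (B (ns @ [k])))" for ns k \<tau>
    unfolding normal_form_def using that
    by - (rule disjI2[OF disjI2[OF disjI2]], rule exI[of _ ns], rule exI[of _ k], simp)
  let ?wilf = "\<lambda>q q'. wilf_equivalent {[1, 4, 3, 2], q} {[1, 4, 3, 2], q'}"
  have alternating: "normal_form (grass (B (replicate l 1)))" if "l \<ge> 4" for l
  proof -
    have l: "composition (replicate l 1)" "replicate l (1::nat) \<noteq> []" using that by auto
    have "distinct_adj (B (replicate l 1))" "num_runs (B (replicate l 1)) \<ge> 4"
      using l that by (simp_all add: distinct_adj_B num_runs_B)
    then show ?thesis
      using form2[of "B (replicate l 1)" "grass (B (replicate l 1))"] G_eq_grass[of "B (replicate l 1)"] hd_B[OF l] B_Nil_iff[OF l(1)] l(2) by simp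
  qed
  \<comment> \<open>The word \<open>w\<close> records the size of \<open>\<tau>\<close> and that it
    is positive.\<close>
  have grass: "\<exists>(w :: bit list) \<tau>. w \<noteq> [] \<and> \<tau> \<in> permutations_of_set {1..length w} \<and> ?wilf (grass v) \<tau> \<and> normal_form \<tau>"
    if v: "v \<noteq> []" "hd v = 0" for v
  proof (cases "num_runs v \<le> 3")
    case True
    then obtain a b c where abc: "a \<ge> 1" "a \<ge> c"
      "?wilf (grass v) (grass (replicate a 0 @ replicate b 1 @ replicate c 0))"
      using grass_three_runs_form[OF v] by blast
    let ?w = "replicate a 0 @ replicate b 1 @ replicate c (0::bit)"
    have w: "?w \<noteq> []" "hd ?w = 0" using abc(1) by (auto simp: hd_append)
    have "normal_form (grass ?w)" using form1[OF abc(1,2), of "grass ?w" b] G_eq_grass[OF w] by simp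
    then show ?thesis
      using abc(3) w(1) grass_perm[of ?w] by - (rule exI[of _ ?w], rule exI[of _ "grass ?w"], intro conjI)
  next
    case False
    then have "num_runs v \<ge> 4" by simp
    from grass_form[OF v this] show ?thesis
    proof (elim disjE exE conjE)
      fix l :: nat assume l: "l \<ge> 4" "?wilf (grass v) (grass (B (replicate l 1)))"
      let ?w = "B (replicate l 1)"
      have "?w \<noteq> []" using l(1) B_Nil_iff[of "replicate l 1"] by auto
      then show ?thesis
        using l alternating[OF l(1)] grass_perm[of ?w] by - (rule exI[of _ ?w], rule exI[of _ "grass ?w"], intro conjI)
    next
      fix ns r assume ns: "ns \<noteq> []" "composition ns" "length ns + r \<ge> 4" "hd ns \<noteq> 1" "last ns \<noteq> 1"
        "rev ns \<le> ns" "?wilf (grass v) (grass (B (ns @ replicate r 1)))"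
      let ?w = "B (ns @ replicate r 1)"
      have comp: "composition (ns @ replicate r 1)" "ns @ replicate r 1 \<noteq> []" using ns by auto
      have w: "?w \<noteq> []" "hd ?w = 0" using B_Nil_iff[OF comp(1)] hd_B[OF comp] comp(2) by auto
      have "num_runs ?w \<ge> 4" using num_runs_B[OF comp(1)] ns(3) by simp
      then have "normal_form (grass ?w)" using form3[of ns r "grass ?w"] ns(1-6) G_eq_grass[OF w] by simp
      then show ?thesis
        using ns(7) w(1) grass_perm[of ?w] by - (rule exI[of _ ?w], rule exI[of _ "grass ?w"], intro conjI)
    qed
  qed
  have inv_grass: "\<exists>(w :: bit list) \<tau>. w \<noteq> [] \<and> \<tau> \<in> permutations_of_set {1..length w} \<and> ?wilf (inv_grass v) \<tau> \<and> normal_form \<tau>"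
    if v: "v \<noteq> []" "hd v = 0" for v
  proof (cases "num_runs v \<le> 4")
    case True
    then obtain a b c d where abcd: "a \<ge> 1" "v = blocks 0 [a, b, c, d]"
      using few_runs_blocks[OF v] by blast
    then have "blocks 0 [a, c, b, d] \<noteq> []" "hd (blocks 0 [a, c, b, d]) = 0"
      by (auto simp: hd_append)
    \<comment> \<open>With at most four runs, exchanging the middle blocks reduces to the case of
      \<open>grass\<close>.\<close>
    then show ?thesis using grass unfolding abcd(2) inv_grass_four_blocks by blast
  next
    case False
    then have "num_runs v \<ge> 5" by simp
    from inv_grass_form[OF v this] show ?thesis
    proof (elim disjE exE conjE)
      fix l :: nat assume l: "l \<ge> 5" "?wilf (inv_grass v) (grass (B (replicate l 1)))"
      let ?w = "B (replicate l 1)"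
      have "?w \<noteq> []" using l(1) B_Nil_iff[of "replicate l 1"] by auto
      moreover have "normal_form (grass (B (replicate l 1)))" using l(1) by (intro alternating) simp
      ultimately show ?thesis
        using l(2) grass_perm[of ?w] by - (rule exI[of _ ?w], rule exI[of _ "grass ?w"], intro conjI)
    next
      fix ns k assume ns: "even (length ns)" "composition ns" "k \<ge> 1" "length ns \<ge> 4"
        "\<not> distinct_adj (B (ns @ [k]))" "rev ns \<le> ns" "?wilf (inv_grass v) (inv_grass (B (ns @ [k])))"
      let ?w = "B (ns @ [k])"
      have comp: "composition (ns @ [k])" "ns @ [k] \<noteq> []" using ns by auto
      have w: "?w \<noteq> []" "hd ?w = 0" using B_Nil_iff[OF comp(1)] hd_B[OF comp] comp(2) by auto
      have "num_runs ?w \<ge> 5" using num_runs_B[OF comp(1)] ns(4) by simp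
      then have "normal_form (inv_grass ?w)" using form4[of ns k "inv_grass ?w"] ns(1-6) IG_eq_inv_grass[OF w] by simp
      then show ?thesis
        using ns(7) w(1) inv_grass_perm[of ?w] by - (rule exI[of _ ?w], rule exI[of _ "inv_grass ?w"], intro conjI)
    qed
  qed
  \<comment> \<open>Only the class of \<open>\<sigma>\<close> matters, so it is replaced by its
    rotation ending in \<open>n\<close>.\<close>
  obtain p where p: "p \<in> circ \<sigma>" "p \<noteq> []" "last p = n"
    using rotation_ending_in_max[OF assms(2,1)] .
  have "p \<in> avoiders n"
    using p assms(3) circ_permutation[OF p(1) assms(2)] circ_contains_cong[OF circ_in_circ[OF p(1)] refl]
    by (simp add: avoiders_def)
  then obtain v where v: "v \<in> zero_words n" "p = grass v \<or> p = inv_grass v" using avoiders_subset by blast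
  then have "v \<noteq> []" "hd v = 0" by (simp_all add: zero_words_def)
  then obtain w :: "bit list" and \<tau> where w: "w \<noteq> []" "\<tau> \<in> permutations_of_set {1..length w}" "?wilf p \<tau>" "normal_form \<tau>"
  proof -
    have "\<exists>(w :: bit list) \<tau>. w \<noteq> [] \<and> \<tau> \<in> permutations_of_set {1..length w} \<and> ?wilf p \<tau> \<and> normal_form \<tau>"
      using v(2) grass[OF \<open>v \<noteq> []\<close> \<open>hd v = 0\<close>] inv_grass[OF \<open>v \<noteq> []\<close> \<open>hd v = 0\<close>] by (elim disjE) (simp_all only:)
    then show ?thesis using that by (elim exE conjE)
  qed
  moreover have "?wilf \<sigma> p" by (rule wilf_equivalent_circ[OF circ_in_circ[OF p(1), symmetric]])
  then have "?wilf \<sigma> \<tau>" using w(3) by (rule wilf_equivalent_trans)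
  moreover have "length w \<ge> 1" using w(1) by (simp add: Suc_leI)
  ultimately show ?thesis
    unfolding normal_form_def[symmetric] by - (rule exI[of _ "length w"], rule exI[of _ \<tau>], intro conjI)
qed

end
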